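(* Let $k\ge1$ and $n\ge 1$ be integers, let $f\in T_{n-1}^\perp$, and let $h>\frac{\pi}{n}\mu$, where $\mu=\mu_{2k}$. Then $$\|f\|\le c_{n,2k}(h)\,\gamma_{2k}^*\,\omega_{2k}(f,h),$$ where $$c_{n,2k}(h)=\left(\cos\frac{\pi}{2}\rho\right)^{-1},\qquad \rho=\frac{\pi\mu}{nh}<1.$$
   Context: All functions are continuous and $2\pi$-periodic on $\mathbb{R}$, $\|\cdot\|$ is the uniform norm, and $T_{n-1}^\perp$ is the set of such $f$ with $\int_{-\pi}^{\pi}f(x)\tau(x)\,dx=0$ for all trigonometric polynomials $\tau$ of degree $\le n-1$. The modulus of smoothness is $\omega_{r}(f,\delta)=\sup_{0<t\le\delta}\|\Delta_t^r(f,\cdot)\|$, where $\Delta_t^r(f,x)=\sum_{i=0}^r(-1)^i\binom{r}{i}f(x+it)$. $\gamma_{2k}^*=\binom{2k}{k}^{-1}$. The number $\mu_{2k}>0$ is defined by $\mu_{2k}^2=\frac{8}{\pi^2}\sum_{1\le i\le k,\ i\text{ odd}}\frac{a_i}{i^2}$ with $a_i=\binom{2k}{k+i}/\binom{2k}{k}$. *)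

theory Defs
  imports "HOL-Analysis.Analysis"
begin

definition periodic_cont :: "(real \<Rightarrow> real) set" where
  "periodic_cont = {f. continuous_on UNIV f \<and> (\<forall>x. f (x + 2 * pi) = f x)}"

(* The suprema in unorm and modulus are over sets of reals; these are bounded
   for functions in periodic_cont, so there Sup is the genuine supremum
   (for modulus, provided that 0 < \<delta>). *)
definition unorm :: "(real \<Rightarrow> real) \<Rightarrow> real" where
  "unorm f = (SUP x. \<bar>f x\<bar>)"

definition trig_poly :: "nat \<Rightarrow> (real \<Rightarrow> real) set" where
  "trig_poly m = {\<tau>. \<exists>a b :: nat \<Rightarrow> real.
     \<tau> = (\<lambda>x. a 0 + (\<Sum>j=1..m. a j * cos (real j * x) + b j * sin (real j * x)))}"

definition trig_perp :: "nat \<Rightarrow> (real \<Rightarrow> real) set" where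
  "trig_perp m = {f \<in> periodic_cont.
     \<forall>\<tau>\<in>trig_poly m. integral {-pi..pi} (\<lambda>x. f x * \<tau> x) = 0}"

definition fdiff :: "nat \<Rightarrow> real \<Rightarrow> (real \<Rightarrow> real) \<Rightarrow> real \<Rightarrow> real" where
  "fdiff r t f x = (\<Sum>i=0..r. (-1) ^ i * real (r choose i) * f (x + real i * t))"

definition modulus :: "nat \<Rightarrow> (real \<Rightarrow> real) \<Rightarrow> real \<Rightarrow> real" where
  "modulus r f \<delta> = (SUP t\<in>{0<..\<delta>}. unorm (fdiff r t f))"

(* gamma_star k, mu k and c_const n k h carry the index k where the mathematical
   notation has 2k. *)
definition gamma_star :: "nat \<Rightarrow> real" where
  "gamma_star k = inverse (real ((2 * k) choose k))"

definition a_coeff :: "nat \<Rightarrow> nat \<Rightarrow> real" where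
  "a_coeff k i = real ((2 * k) choose (k + i)) / real ((2 * k) choose k)"

definition mu :: "nat \<Rightarrow> real" where
  "mu k = sqrt (8 / pi\<^sup>2 * (\<Sum>i | 1 \<le> i \<and> i \<le> k \<and> odd i. a_coeff k i / (real i)\<^sup>2))"

lemma mu_pos_square:
  assumes "k \<ge> 1"
  shows "mu k > 0"
    and "(mu k)\<^sup>2 = 8 / pi\<^sup>2 * (\<Sum>i | 1 \<le> i \<and> i \<le> k \<and> odd i. a_coeff k i / (real i)\<^sup>2)"
proof -
  let ?S = "\<Sum>i | 1 \<le> i \<and> i \<le> k \<and> odd i. a_coeff k i / (real i)\<^sup>2"
  have "?S > 0"
  proof (rule sum_pos)
    show "finite {i. 1 \<le> i \<and> i \<le> k \<and> odd i}" by simp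
    have "1 \<in> {i. 1 \<le> i \<and> i \<le> k \<and> odd i}" using assms by simp
    then show "{i. 1 \<le> i \<and> i \<le> k \<and> odd i} \<noteq> {}" by blast
  qed (auto simp: a_coeff_def intro!: divide_pos_pos zero_less_binomial)
  then have *: "8 / pi\<^sup>2 * ?S > 0" by simp
  show "mu k > 0" unfolding mu_def using * by (simp only: real_sqrt_gt_0_iff)
  show "(mu k)\<^sup>2 = 8 / pi\<^sup>2 * ?S"
    unfolding mu_def using * by (intro real_sqrt_pow2) simp
qed

definition rho :: "nat \<Rightarrow> nat \<Rightarrow> real \<Rightarrow> real" where
  "rho n k h = pi * mu k / (real n * h)"

definition c_const :: "nat \<Rightarrow> nat \<Rightarrow> real \<Rightarrow> real" where
  "c_const n k h = inverse (cos (pi / 2 * rho n k h))"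

end

theory Submission
  imports Defs "HOL-Library.Periodic_Fun"
begin

text \<open>
  Let \<open>F'' = - f\<close> with \<open>F\<close> periodic and orthogonal to the same trigonometric polynomials as
  \<open>f\<close>. The central difference of \<open>f\<close> of order \<open>2 k\<close> and step \<open>\<tau> h\<close>, divided by
  \<open>(2 k choose k)\<close>, is \<open>f x\<close> plus a combination of \<open>f (x + i \<tau> h) + f (x - i \<tau> h)\<close> for
  \<open>1 \<le> i \<le> k\<close>. Averaging it over \<open>0 \<le> \<tau> \<le> 1\<close> with weight \<open>2 (1 - \<tau>)\<close> gives a function
  \<open>g = f - D F\<close> that is bounded by \<open>gamma_star k * modulus (2 * k) f h\<close>, where \<open>D F\<close> is
  an explicit combination of translates of \<open>F\<close> (\<open>averaged_difference_bound\<close>). The absolute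
  values of its coefficients sum to \<open>\<nu>\<^sup>2\<close> with \<open>\<nu> = \<pi> mu k / h\<close>
  (\<open>sum_abs_centred_coeff\<close>), and \<open>\<nu> / n = rho n k h < 1\<close>.

  It remains to show that \<open>\<bar>f - D F\<bar> \<le> M\<close> implies
  \<open>\<bar>f\<bar> \<le> M / cos (\<nu> \<pi> / (2 n))\<close> (\<open>perturbed_bohr_favard\<close>). If \<open>A\<close> takes \<open>f\<close> to \<open>F\<close>,
  this amounts to bounding the Neumann series of \<open>(1 - D A)\<^bsup>-1\<^esup>\<close> by the sum of the
  \<open>\<nu>\<^bsup>2m\<^esup> \<parallel>A\<^bsup>m\<^esup>\<parallel>\<close>; the point is that the norms of all \<open>A\<^bsup>m\<^esup>\<close> are
  attained at one and the same function. Poisson means make this visible. The Poisson mean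
  \<open>P\<^sub>s f\<close> is harmonic, so \<open>(P\<^sub>s F)'' = P\<^sub>s f\<close> as functions of \<open>s\<close>: inverting two derivatives
  in \<open>x\<close> becomes integrating twice in \<open>s\<close> from infinity, which preserves inequalities
  (\<open>convex_tendsto_0_nonneg\<close>). And on functions orthogonal to the trigonometric polynomials of
  degree below \<open>n\<close>, the Poisson kernel acts as a kernel with the sign of \<open>cos (n t)\<close>
  (\<open>poisson_interpolation\<close>), so that for every \<open>s\<close> the norm of \<open>P\<^sub>s\<close> is attained at the
  square wave \<open>sgn (cos (n t))\<close>. Therefore \<open>f\<close> is dominated by the solution for the square
  wave and \<open>D = \<nu>\<^sup>2\<close>, where \<open>f - \<nu>\<^sup>2 F = sgn (cos (n t))\<close> is a linear differential
  equation with constant coefficients; its solution is \<open>cos (\<nu> t) / cos (\<nu> \<pi> / (2 n))\<close> on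
  \<open>\<bar>t\<bar> < \<pi> / (2 n)\<close>, and the constant is its value at \<open>0\<close>.
\<close>

section \<open>Periodic functions and their primitives\<close>

lemma continuous_has_primitive:
  fixes f :: "real \<Rightarrow> real"
  assumes "continuous_on UNIV f"
  obtains F where "\<And>x. (F has_real_derivative f x) (at x)"
proof -
  have "\<exists>F. \<forall>x::real. -\<infinity> < ereal x \<longrightarrow> ereal x < \<infinity> \<longrightarrow> (F has_vector_derivative f x) (at x)"
    by (rule einterval_antiderivative) (use assms in \<open>auto simp: continuous_on_eq_continuous_at\<close>)
  then show thesis
    using that by (auto simp: has_real_derivative_iff_has_vector_derivative)
qed

lemma integral_primitive_diff:
  fixes f F :: "real \<Rightarrow> real"
  assumes "\<And>x. (F has_real_derivative f x) (at x)" "a \<le> b"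
  shows "integral {a..b} f = F b - F a"
  using assms
  by (intro integral_unique fundamental_theorem_of_calculus)
     (auto simp: has_real_derivative_iff_has_vector_derivative[symmetric] intro: has_field_derivative_at_within)

lemma integral_period_shift:
  fixes f :: "real \<Rightarrow> real"
  assumes cont: "continuous_on UNIV f" and per: "\<And>x. f (x + 2 * pi) = f x"
  shows "integral {-pi..pi} (\<lambda>t. f (x + t)) = integral {-pi..pi} f"
proof -
  obtain F where F: "\<And>x. (F has_real_derivative f x) (at x)"
    using continuous_has_primitive[OF cont] by blast
  have "((\<lambda>y. F (y + 2 * pi) - F y) has_real_derivative 0) (at y)" for y
    by (auto intro!: derivative_eq_intros DERIV_chain2[OF F, THEN DERIV_cong] F simp: per)
  then have const: "F (y + 2 * pi) - F y = F (z + 2 * pi) - F z" for y z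
    by (intro DERIV_isconst_all[of "\<lambda>y. F (y + 2 * pi) - F y"]) auto
  have "((\<lambda>t. F (x + t)) has_real_derivative f (x + t)) (at t)" for t
    by (auto intro!: derivative_eq_intros DERIV_chain2[OF F, THEN DERIV_cong])
  then have "integral {-pi..pi} (\<lambda>t. f (x + t)) = F (x + pi) - F (x + - pi)"
    by (rule integral_primitive_diff) simp
  moreover have "integral {-pi..pi} f = F pi - F (- pi)"
    by (rule integral_primitive_diff[OF F]) simp
  ultimately show ?thesis
    using const[of "x - pi" "- pi"] by (simp add: add.commute)
qed

lemma continuous_periodic_bounded:
  fixes f :: "real \<Rightarrow> real"
  assumes cont: "continuous_on UNIV f" and per: "\<And>x. f (x + 2 * pi) = f x"
  obtains B where "\<And>x. \<bar>f x\<bar> \<le> B"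
proof -
  interpret periodic_fun_simple f "2 * pi"
    by unfold_locales (rule per)
  have "compact (f ` {0..2 * pi})"
    by (intro compact_continuous_image continuous_on_subset[OF cont]) auto
  then obtain B where B: "\<And>x. x \<in> {0..2 * pi} \<Longrightarrow> \<bar>f x\<bar> \<le> B"
    by (force dest: compact_imp_bounded simp: bounded_iff)
  have "\<bar>f x\<bar> \<le> B" for x
  proof -
    define m where "m = \<lfloor>x / (2 * pi)\<rfloor>"
    have "of_int m * (2 * pi) \<le> x" "x \<le> (of_int m + 1) * (2 * pi)"
      unfolding m_def
      using of_int_floor_le[of "x / (2*pi)"] floor_correct[of "x / (2*pi)"]
      by (auto simp: field_simps simp del: of_int_floor_le)
    then have "x - of_int m * (2 * pi) \<in> {0..2 * pi}"
      by (auto simp: algebra_simps)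
    from B[OF this] show ?thesis
      by (simp add: minus_of_int)
  qed
  then show thesis by (rule that)
qed

definition mean_zero :: "(real \<Rightarrow> real) \<Rightarrow> bool" where
  "mean_zero f \<longleftrightarrow> integral {-pi..pi} f = 0"

lemma periodic_mean_zero_primitive:
  fixes f :: "real \<Rightarrow> real"
  assumes cont: "continuous_on UNIV f" and per: "\<And>x. f (x + 2 * pi) = f x" and "mean_zero f"
  obtains F where "\<And>x. (F has_real_derivative f x) (at x)"
    "\<And>x. F (x + 2 * pi) = F x" "mean_zero F"
proof -
  obtain G where G: "\<And>x. (G has_real_derivative f x) (at x)"
    using continuous_has_primitive[OF cont] by blast
  have G_cont: "continuous_on A G" for A
    using G by (meson DERIV_isCont continuous_at_imp_continuous_on)
  define m where "m = integral {-pi..pi} G / (2 * pi)"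
  define F where "F x = G x - m" for x
  have F: "(F has_real_derivative f x) (at x)" for x
    unfolding F_def by (auto intro!: derivative_eq_intros G)
  have "F (x + 2 * pi) = F x" for x
  proof -
    have "((\<lambda>t. F (x + pi + t)) has_real_derivative f (x + pi + t)) (at t)" for t
      by (auto intro!: derivative_eq_intros DERIV_chain2[OF F, THEN DERIV_cong])
    then have "integral {-pi..pi} (\<lambda>t. f (x + pi + t)) = F (x + pi + pi) - F (x + pi + - pi)"
      by (rule integral_primitive_diff) simp
    also have "x + pi + pi = x + 2 * pi" by simp
    finally show ?thesis
      using integral_period_shift[OF cont per, of "x + pi"] \<open>mean_zero f\<close>
      by (simp add: mean_zero_def)
  qed
  moreover have "mean_zero F"
    unfolding mean_zero_def F_def
    by (subst integral_diff) (auto intro!: integrable_continuous_real G_cont simp: m_def)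
  ultimately show thesis
    using F that by blast
qed

section \<open>The Poisson kernel\<close>

text \<open>With \<open>q = exp (- s)\<close> this is the classical \<open>(1 - q\<^sup>2) / (1 - 2 q cos t + q\<^sup>2)\<close>.
  The variable \<open>s\<close> is the height in the upper half plane, which makes the kernel harmonic
  in \<open>(t, s)\<close>.\<close>

definition poisson :: "real \<Rightarrow> real \<Rightarrow> real" where
  "poisson s t = sinh s / (cosh s - cos t)"

definition poisson_mean :: "real \<Rightarrow> (real \<Rightarrow> real) \<Rightarrow> real" where
  "poisson_mean s f = integral {-pi..pi} (\<lambda>t. poisson s t * f t) / (2 * pi)"

lemma cosh_gt_cos: "s > 0 \<Longrightarrow> cos t < cosh (s::real)"
proof -
  assume "s > 0"
  then have "cosh s > cosh 0" by (subst cosh_real_nonneg_less_iff) auto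
  then have "1 < cosh s" by simp
  with cos_le_one[of t] show ?thesis by (rule le_less_trans)
qed

lemma poisson_pos: "s > 0 \<Longrightarrow> poisson s t > 0"
  using cosh_gt_cos[of s t] by (simp add: poisson_def)

lemma poisson_continuous [continuous_intros]:
  "s > 0 \<Longrightarrow> continuous_on A (\<lambda>t. poisson s t)"
  unfolding poisson_def
  by (intro continuous_intros) (metis cosh_gt_cos less_irrefl right_minus_eq)

text \<open>The trigonometric polynomial of degree below \<open>n\<close> that interpolates
  \<open>cosh (n s) * poisson s\<close> at the zeros of \<open>cos (n t)\<close>.\<close>

definition poisson_interpolant :: "nat \<Rightarrow> real \<Rightarrow> real \<Rightarrow> real" where
  "poisson_interpolant n s t =
     sinh (real n * s) + 2 * (\<Sum>j=1..<n. sinh (real (n - j) * s) * cos (real j * t))"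

lemma poisson_interpolant_rec:
  assumes "n \<ge> 1"
  shows "poisson_interpolant (Suc n) s t =
    2 * cosh s * poisson_interpolant n s t - poisson_interpolant (n - 1) s t
      + 2 * sinh s * cos (real n * t)"
proof -
  have sinh_rec: "sinh (real (Suc m) * s) = 2 * cosh s * sinh (real m * s) - sinh (real (m - 1) * s)"
    if "m \<ge> 1" for m
  proof -
    have "real (Suc m) * s = real m * s + s" "real (m - 1) * s = real m * s - s"
      using that by (auto simp: algebra_simps of_nat_diff)
    then show ?thesis by (simp add: sinh_add sinh_diff)
  qed
  have n: "{1..<Suc n} = insert n {1..<n}" using assms by auto
  have n': "{1..<n} = (if n = 1 then {} else insert (n - 1) {1..<n - 1})" using assms by auto
  (* The last summand of the longer sum is sinh 0. *)
  have short: "(\<Sum>j=1..<n - 1. sinh (real (n - 1 - j) * s) * cos (real j * t))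
      = (\<Sum>j=1..<n. sinh (real (n - j - 1) * s) * cos (real j * t))"
    by (subst n') (auto simp: diff_commute)
  have "(\<Sum>j=1..<n. sinh (real (Suc n - j) * s) * cos (real j * t))
      = (\<Sum>j=1..<n. (2 * cosh s * sinh (real (n - j) * s) - sinh (real (n - j - 1) * s)) * cos (real j * t))"
  proof (rule sum.cong)
    fix j assume "j \<in> {1..<n}"
    then have "n - j \<ge> 1" "Suc n - j = Suc (n - j)" by auto
    then show "sinh (real (Suc n - j) * s) * cos (real j * t)
        = (2 * cosh s * sinh (real (n - j) * s) - sinh (real (n - j - 1) * s)) * cos (real j * t)"
      using sinh_rec[of "n - j"] by simp
  qed simp
  also have "\<dots> = 2 * cosh s * (\<Sum>j=1..<n. sinh (real (n - j) * s) * cos (real j * t))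
      - (\<Sum>j=1..<n - 1. sinh (real (n - 1 - j) * s) * cos (real j * t))"
    unfolding short by (simp add: sum_distrib_left sum_subtractf algebra_simps)
  finally show ?thesis
    using sinh_rec[OF assms] unfolding poisson_interpolant_def
    by (subst n) (simp add: algebra_simps)
qed

text \<open>Both sides satisfy the same three-term recurrence in \<open>n\<close>. The identity shows that, on
  functions orthogonal to all trigonometric polynomials of degree below \<open>n\<close>, the Poisson kernel
  acts as \<open>poisson s t * cos (n t) / cosh (n s)\<close>, whose sign is that of \<open>cos (n t)\<close>
  for every \<open>s\<close>.\<close>

lemma poisson_interpolation:
  assumes "s > 0"
  shows "cosh (real n * s) * poisson s t
    = poisson_interpolant n s t + poisson s t * cos (real n * t)"
proof -
  have ne: "cosh s - cos t \<noteq> 0" using cosh_gt_cos[OF assms, of t] by simp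
  have "(cosh (real n * s) - cos (real n * t)) * sinh s
      = (cosh s - cos t) * poisson_interpolant n s t"
  proof (induction n rule: less_induct)
    case (less n)
    consider "n = 0" | "n = 1" | m where "n = Suc m" "m \<ge> 1"
      by (cases n) (auto simp: not_less_eq_eq, metis One_nat_def Suc_leI gr0I)
    then show ?case
    proof cases
      case 3
      have m: "real n * x = real m * x + x" "real (m - 1) * x = real m * x - x" for x :: real
        using 3 by (auto simp: algebra_simps of_nat_diff)
      have IH1: "(cosh (real m * s) - cos (real m * t)) * sinh s
          = (cosh s - cos t) * poisson_interpolant m s t"
        by (rule less.IH) (use 3 in simp)
      have IH2: "(cosh (real m * s - s) - cos (real m * t - t)) * sinh s
          = (cosh s - cos t) * poisson_interpolant (m - 1) s t"
        using less.IH[of "m - 1"] 3 unfolding m by simp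
      have "(cosh s - cos t) * poisson_interpolant n s t =
          2 * cosh s * ((cosh s - cos t) * poisson_interpolant m s t)
          - (cosh s - cos t) * poisson_interpolant (m - 1) s t
          + 2 * (cosh s - cos t) * sinh s * cos (real m * t)"
        unfolding 3(1) poisson_interpolant_rec[OF \<open>m \<ge> 1\<close>] by (simp add: algebra_simps)
      also have "\<dots> = (cosh (real m * s + s) - cos (real m * t + t)) * sinh s"
        unfolding IH1[symmetric] IH2[symmetric]
        by (simp add: cosh_add cosh_diff cos_add cos_diff algebra_simps)
      finally show ?thesis unfolding m by simp
    qed (auto simp: poisson_interpolant_def)
  qed
  then show ?thesis
    using ne by (simp add: poisson_def field_simps)
qed

text \<open>Only cosines are tested; for periodic functions all of whose translates satisfy this, the
  sines follow.\<close>

definition orthogonal_below :: "nat \<Rightarrow> (real \<Rightarrow> real) \<Rightarrow> bool" where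
  "orthogonal_below n f \<longleftrightarrow> (\<forall>j<n. integral {-pi..pi} (\<lambda>t. cos (real j * t) * f t) = 0)"

lemma poisson_interpolant_orthogonal:
  assumes "orthogonal_below n f" "continuous_on {-pi..pi} f"
  shows "integral {-pi..pi} (\<lambda>t. poisson_interpolant n s t * f t) = 0"
proof (cases "n = 0")
  case False
  have *: "integral {-pi..pi} (\<lambda>t. cos (real j * t) * f t) = 0" if "j < n" for j
    using assms(1) that by (simp add: orthogonal_below_def)
  have int: "(\<lambda>t. c * (cos (real j * t) * f t)) integrable_on {-pi..pi}" for j c
    by (intro integrable_continuous_real continuous_intros assms)
  have expand: "(\<lambda>t. poisson_interpolant n s t * f t) =
      (\<lambda>t. sinh (real n * s) * (cos (real 0 * t) * f t)
        + (\<Sum>j=1..<n. 2 * sinh (real (n - j) * s) * (cos (real j * t) * f t)))"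
    by (auto simp: poisson_interpolant_def fun_eq_iff algebra_simps sum_distrib_left sum_distrib_right)
  show ?thesis
    unfolding expand using False *[of 0]
    by (subst integral_add)
       (auto intro!: int[of _ 0, simplified] integrable_sum int simp: integral_sum[OF _ int] *)
qed (simp add: poisson_interpolant_def)

lemma poisson_mean_orthogonal_below:
  assumes "s > 0" "orthogonal_below n f" "continuous_on {-pi..pi} f"
  shows "cosh (real n * s) * poisson_mean s f
    = integral {-pi..pi} (\<lambda>t. poisson s t * cos (real n * t) * f t) / (2 * pi)"
proof -
  have "cosh (real n * s) * integral {-pi..pi} (\<lambda>t. poisson s t * f t)
      = integral {-pi..pi} (\<lambda>t. poisson_interpolant n s t * f t + poisson s t * cos (real n * t) * f t)"
    unfolding integral_mult_right[symmetric]
    by (rule arg_cong[of _ _ "integral _"])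
       (auto simp: fun_eq_iff poisson_interpolation[OF assms(1), of n] mult.assoc[symmetric] distrib_right[symmetric])
  also have "\<dots> = integral {-pi..pi} (\<lambda>t. poisson s t * cos (real n * t) * f t)"
    using poisson_interpolant_orthogonal[OF assms(2,3)]
    by (subst integral_add)
       (auto intro!: integrable_continuous_real continuous_intros assms simp: poisson_interpolant_def)
  finally show ?thesis
    by (simp add: poisson_mean_def)
qed

text \<open>Integrating the interpolation identity gives \<open>cosh (n s) I = 2 \<pi> sinh (n s) + O(I)\<close>
  for the total mass \<open>I\<close>; now let \<open>n\<close> tend to infinity.\<close>

lemma poisson_mass:
  assumes "s > 0"
  shows "integral {-pi..pi} (poisson s) = 2 * pi"
proof -
  define I where "I = integral {-pi..pi} (poisson s)"
  have cos_int: "integral {-pi..pi} (\<lambda>t. cos (real j * t)) = 0" if "j \<noteq> 0" for j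
  proof -
    have "integral {-pi..pi} (\<lambda>t. cos (real j * t)) = sin (real j * pi) / real j - sin (real j * - pi) / real j"
      using that by (intro integral_primitive_diff) (auto intro!: derivative_eq_intros)
    then show ?thesis by simp
  qed
  have mass: "integral {-pi..pi} (poisson_interpolant n s) = 2 * pi * sinh (real n * s)" for n
  proof -
    have int: "(\<lambda>t. c * cos (real j * t)) integrable_on {-pi..pi}" for j c
      by (intro integrable_continuous_real continuous_intros)
    have expand: "poisson_interpolant n s = (\<lambda>t. sinh (real n * s)
        + (\<Sum>j=1..<n. 2 * sinh (real (n - j) * s) * cos (real j * t)))"
      by (auto simp: poisson_interpolant_def fun_eq_iff sum_distrib_left mult_ac)
    show ?thesis
      unfolding expand by (subst integral_add) (auto intro!: integrable_sum int simp: integral_sum[OF _ int] cos_int)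
  qed
  have bound: "\<bar>I - 2 * pi * tanh (real n * s)\<bar> \<le> I / cosh (real n * s)" for n
  proof -
    have "cosh (real n * s) * I - integral {-pi..pi} (poisson_interpolant n s)
        = integral {-pi..pi} (\<lambda>t. cosh (real n * s) * poisson s t - poisson_interpolant n s t)"
      unfolding I_def
      by (subst integral_diff)
         (auto intro!: integrable_continuous_real continuous_intros assms simp: poisson_interpolant_def)
    also have "\<dots> = integral {-pi..pi} (\<lambda>t. poisson s t * cos (real n * t))"
      by (simp add: poisson_interpolation[OF assms])
    also have "\<bar>\<dots>\<bar> \<le> I"
      unfolding I_def real_norm_def[symmetric]
      using poisson_pos[OF assms]
      by (intro integral_norm_bound_integral)
         (auto intro!: integrable_continuous_real continuous_intros assms simp: abs_mult mult_le_cancel_left1 less_le_not_le)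
    finally have "\<bar>cosh (real n * s) * I - 2 * pi * sinh (real n * s)\<bar> / cosh (real n * s) \<le> I / cosh (real n * s)"
      by (simp add: mass divide_right_mono)
    moreover have "\<bar>cosh (real n * s) * I - 2 * pi * sinh (real n * s)\<bar> / cosh (real n * s)
        = \<bar>(cosh (real n * s) * I - 2 * pi * sinh (real n * s)) / cosh (real n * s)\<bar>"
      by simp
    ultimately show ?thesis
      by (simp add: diff_divide_distrib tanh_def)
  qed
  have lim: "filterlim (\<lambda>n. real n * s) at_top sequentially"
    using filterlim_tendsto_pos_mult_at_top[OF tendsto_const[of s] assms filterlim_real_sequentially]
    by (simp add: mult.commute)
  have "(\<lambda>n. \<bar>I - 2 * pi * tanh (real n * s)\<bar>) \<longlonglongrightarrow> \<bar>I - 2 * pi * 1\<bar>"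
    by (intro tendsto_intros filterlim_compose[OF tanh_real_at_top lim])
  moreover have "(\<lambda>n. I / cosh (real n * s)) \<longlonglongrightarrow> 0"
    by (intro tendsto_divide_0[OF tendsto_const] filterlim_at_top_imp_at_infinity
        filterlim_compose[OF cosh_real_at_top lim])
  ultimately have "\<bar>I - 2 * pi * 1\<bar> \<le> 0"
    by (rule LIMSEQ_le) (use bound in auto)
  then show ?thesis by (simp add: I_def)
qed

section \<open>Poisson means\<close>

lemma poisson_mean_limit:
  assumes cont: "continuous_on UNIV f" and bound: "\<And>t. \<bar>f t\<bar> \<le> B"
  shows "((\<lambda>s. poisson_mean s f) \<longlongrightarrow> f 0) (at_right 0)"
proof (rule tendstoI)
  fix e :: real assume "e > 0"
  have "isCont f 0" using cont by (simp add: continuous_on_eq_continuous_at)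
  then obtain d where d: "d > 0" "\<And>t. \<bar>t\<bar> < d \<Longrightarrow> \<bar>f t - f 0\<bar> < e / 2"
    using \<open>e > 0\<close> unfolding continuous_at_eps_delta
    by (metis dist_real_def diff_zero half_gt_zero)
  define d' where "d' = min d pi"
  have d': "0 < d'" "d' \<le> d" "d' \<le> pi" using d pi_gt_zero by (auto simp: d'_def)
  have B: "B \<ge> 0" using bound[of 0] by simp
  have cd: "cos d' < 1"
    using cos_monotone_0_pi[of 0 d'] d' by simp
  define C where "C = 2 * B / (1 - cos d')"
  have C: "C \<ge> 0" using cd B by (simp add: C_def)
  (* Away from 0 the factor 1 - cos t is bounded below, and it cancels the denominator of the
     kernel up to cosh s - 1, so its integral against the kernel is O(sinh s). *)
  have pointwise: "\<bar>f t - f 0\<bar> \<le> e / 2 + C * (1 - cos t)" if "t \<in> {-pi..pi}" for t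
  proof (cases "\<bar>t\<bar> < d'")
    case True
    then have "\<bar>f t - f 0\<bar> \<le> e / 2" using d(2)[of t] d' by simp
    moreover have "C * (1 - cos t) \<ge> 0" using C by simp
    ultimately show ?thesis by simp
  next
    case False
    have "cos \<bar>t\<bar> \<le> cos d'"
      using False d' that by (intro cos_monotone_0_pi_le) auto
    then have "1 - cos d' \<le> 1 - cos t" by simp
    then have "C * (1 - cos d') \<le> C * (1 - cos t)" using C by (rule mult_left_mono)
    moreover have "C * (1 - cos d') = 2 * B" using cd by (simp add: C_def)
    moreover have "\<bar>f t - f 0\<bar> \<le> 2 * B" using bound[of t] bound[of 0] by linarith
    ultimately show ?thesis using \<open>e > 0\<close> by linarith
  qed
  have estimate: "\<bar>poisson_mean s f - f 0\<bar> \<le> e / 2 + C * sinh s" if "s > 0" for s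
  proof -
    have cf: "continuous_on {-pi..pi} f" using cont by (rule continuous_on_subset) simp
    have "2 * pi * (poisson_mean s f - f 0)
        = integral {-pi..pi} (\<lambda>t. poisson s t * f t) - integral {-pi..pi} (\<lambda>t. poisson s t * f 0)"
      using poisson_mass[OF that] by (simp add: poisson_mean_def right_diff_distrib)
    also have "\<dots> = integral {-pi..pi} (\<lambda>t. poisson s t * (f t - f 0))"
      by (subst integral_diff[symmetric])
         (auto intro!: integrable_continuous_real continuous_intros that cf simp: right_diff_distrib)
    also have "\<bar>\<dots>\<bar> \<le> integral {-pi..pi} (\<lambda>t. poisson s t * (e / 2) + C * sinh s)"
      unfolding real_norm_def[symmetric]
    proof (rule integral_norm_bound_integral)
      fix t assume t: "t \<in> {-pi..pi}"
      have "poisson s t * (1 - cos t) \<le> poisson s t * (cosh s - cos t)"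
        using poisson_pos[OF that, of t] cosh_real_ge_1[of s] by (intro mult_left_mono) auto
      also have "\<dots> = sinh s"
        using cosh_gt_cos[OF that, of t] by (simp add: poisson_def)
      finally have "C * (poisson s t * (1 - cos t)) \<le> C * sinh s"
        using C by (rule mult_left_mono)
      moreover have "poisson s t * \<bar>f t - f 0\<bar> \<le> poisson s t * (e / 2 + C * (1 - cos t))"
        using poisson_pos[OF that, of t] pointwise[OF t] by (intro mult_left_mono) auto
      moreover have "norm (poisson s t * (f t - f 0)) = poisson s t * \<bar>f t - f 0\<bar>"
        using poisson_pos[OF that, of t] by (simp add: abs_mult)
      ultimately show "norm (poisson s t * (f t - f 0)) \<le> poisson s t * (e / 2) + C * sinh s"
        by (simp add: algebra_simps)
    qed (auto intro!: integrable_continuous_real continuous_intros that cf)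
    also have "\<dots> = 2 * pi * (e / 2 + C * sinh s)"
      using poisson_mass[OF that]
      by (subst integral_add)
         (auto intro!: integrable_continuous_real continuous_intros that simp: algebra_simps)
    finally have "2 * pi * \<bar>poisson_mean s f - f 0\<bar> \<le> 2 * pi * (e / 2 + C * sinh s)"
      by (simp add: abs_mult)
    then show ?thesis by simp
  qed
  have "((\<lambda>s. e / 2 + C * sinh s) \<longlongrightarrow> e / 2 + C * sinh 0) (at_right (0::real))"
    by (intro tendsto_intros)
  then have "eventually (\<lambda>s. e / 2 + C * sinh s < e) (at_right 0)"
    using \<open>e > 0\<close> order_tendstoD(2)[of _ "e / 2" _ e] by simp
  moreover have "eventually (\<lambda>s::real. s > 0) (at_right 0)"
    by (simp add: eventually_at_right_less)
  ultimately show "eventually (\<lambda>s. dist (poisson_mean s f) (f 0) < e) (at_right 0)"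
    by eventually_elim (use estimate in \<open>force simp: dist_real_def\<close>)
qed

text \<open>The norm of the functional \<open>poisson_mean s\<close> on the bounded functions orthogonal to the
  trigonometric polynomials of degree below \<open>n\<close>. The square wave \<open>sgn (cos (n t))\<close> is
  extremal for every \<open>s\<close> at once.\<close>

definition poisson_norm :: "nat \<Rightarrow> real \<Rightarrow> real" where
  "poisson_norm n s =
     integral {-pi..pi} (\<lambda>t. poisson s t * \<bar>cos (real n * t)\<bar>) / (2 * pi * cosh (real n * s))"

lemma poisson_norm_bounds:
  assumes "s > 0"
  shows "0 \<le> poisson_norm n s" "poisson_norm n s \<le> 1 / cosh (real n * s)"
proof -
  have int: "(\<lambda>t. poisson s t * \<bar>cos (real n * t)\<bar>) integrable_on {-pi..pi}"
    by (intro integrable_continuous_real continuous_intros assms)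
  have "integral {-pi..pi} (\<lambda>t. poisson s t * \<bar>cos (real n * t)\<bar>) \<ge> 0"
    using int poisson_pos[OF assms] by (intro integral_nonneg) (auto simp: less_imp_le)
  then show "0 \<le> poisson_norm n s" by (simp add: poisson_norm_def)
  have "integral {-pi..pi} (\<lambda>t. poisson s t * \<bar>cos (real n * t)\<bar>) \<le> integral {-pi..pi} (poisson s)"
    using poisson_pos[OF assms]
    by (intro integral_le int integrable_continuous_real continuous_intros assms)
       (simp add: mult_le_cancel_left1 less_imp_le)
  then show "poisson_norm n s \<le> 1 / cosh (real n * s)"
    using poisson_mass[OF assms] by (simp add: poisson_norm_def divide_simps)
qed

lemma poisson_mean_le_norm:
  assumes "s > 0" "orthogonal_below n f" "continuous_on {-pi..pi} f" "\<And>t. \<bar>f t\<bar> \<le> M"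
  shows "\<bar>poisson_mean s f\<bar> \<le> M * poisson_norm n s"
proof -
  have "\<bar>integral {-pi..pi} (\<lambda>t. poisson s t * cos (real n * t) * f t)\<bar>
      \<le> integral {-pi..pi} (\<lambda>t. M * (poisson s t * \<bar>cos (real n * t)\<bar>))"
    unfolding real_norm_def[symmetric]
  proof (rule integral_norm_bound_integral)
    show "norm (poisson s t * cos (real n * t) * f t) \<le> M * (poisson s t * norm (cos (real n * t)))" for t
      using mult_left_mono[OF assms(4)[of t], of "poisson s t * \<bar>cos (real n * t)\<bar>"] poisson_pos[OF assms(1), of t]
      by (simp add: abs_mult mult_ac)
  qed (auto intro!: integrable_continuous_real continuous_intros assms)
  then have "cosh (real n * s) * \<bar>poisson_mean s f\<bar> \<le> cosh (real n * s) * (M * poisson_norm n s)"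
    using poisson_mean_orthogonal_below[OF assms(1-3)]
    by (simp add: poisson_norm_def abs_mult divide_simps)
  then show ?thesis by simp
qed

lemma poisson_mean_tendsto_0:
  assumes "n \<ge> 1" "orthogonal_below n f" "continuous_on {-pi..pi} f" "\<And>t. \<bar>f t\<bar> \<le> M"
  shows "((\<lambda>s. poisson_mean s f) \<longlongrightarrow> 0) at_top"
proof (rule Lim_null_comparison)
  have "M \<ge> 0" using assms(4)[of 0] by simp
  then have "\<bar>poisson_mean s f\<bar> \<le> M * (1 / cosh (real n * s))" if "s > 0" for s
    using poisson_mean_le_norm[OF that assms(2-4)] mult_left_mono[OF poisson_norm_bounds(2)[OF that, of n]]
    by (meson order_trans)
  then show "eventually (\<lambda>s. norm (poisson_mean s f) \<le> M * (1 / cosh (real n * s))) at_top"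
    by (auto intro!: eventually_mono[OF eventually_gt_at_top[of 0]])
  have lim: "filterlim (\<lambda>s. real n * s) at_top at_top"
    using assms(1) by (intro filterlim_tendsto_pos_mult_at_top[OF tendsto_const] filterlim_ident) auto
  have "((\<lambda>s. 1 / cosh (real n * s)) \<longlongrightarrow> 0) at_top"
    by (intro tendsto_divide_0[OF tendsto_const] filterlim_at_top_imp_at_infinity
        filterlim_compose[OF cosh_real_at_top lim])
  from tendsto_mult_right_zero[OF this]
  show "((\<lambda>s. M * (1 / cosh (real n * s))) \<longlongrightarrow> 0) at_top" .
qed

text \<open>The regularity that the argument needs of \<open>w\<close>: it is \<open>C\<^sup>1\<close> and periodic, and its
  derivative is a primitive of \<open>z\<close> up to finitely many jumps of \<open>z\<close>.\<close>

definition periodic_second_primitive :: "(real \<Rightarrow> real) \<Rightarrow> (real \<Rightarrow> real) \<Rightarrow> bool" where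
  "periodic_second_primitive w z \<longleftrightarrow> (\<exists>v S. finite S \<and>
     continuous_on {-pi..pi} w \<and> continuous_on {-pi..pi} v \<and>
     (\<forall>t\<in>{-pi<..<pi} - S. (w has_real_derivative v t) (at t)) \<and>
     (\<forall>t\<in>{-pi<..<pi} - S. (v has_real_derivative z t) (at t)) \<and>
     w (-pi) = w pi \<and> v (-pi) = v pi)"

text \<open>Green's formula: \<open>(\<phi> v - \<phi>' w)' = \<phi> z - \<phi>'' w\<close>.\<close>

lemma periodic_green:
  assumes "periodic_second_primitive w z"
    and \<phi>: "\<And>t. (\<phi> has_real_derivative \<phi>' t) (at t)" "\<And>t. (\<phi>' has_real_derivative \<phi>'' t) (at t)"
    and cont: "continuous_on {-pi..pi} \<phi>''"
    and per: "\<phi> (-pi) = \<phi> pi" "\<phi>' (-pi) = \<phi>' pi"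
  shows "((\<lambda>t. \<phi> t * z t) has_integral integral {-pi..pi} (\<lambda>t. \<phi>'' t * w t)) {-pi..pi}"
proof -
  obtain v S where *: "finite S" "continuous_on {-pi..pi} w" "continuous_on {-pi..pi} v"
     "\<And>t. t \<in> {-pi<..<pi} - S \<Longrightarrow> (w has_real_derivative v t) (at t)"
     "\<And>t. t \<in> {-pi<..<pi} - S \<Longrightarrow> (v has_real_derivative z t) (at t)"
     "w (-pi) = w pi" "v (-pi) = v pi"
    using assms(1) unfolding periodic_second_primitive_def by blast
  have c: "continuous_on {-pi..pi} \<phi>" "continuous_on {-pi..pi} \<phi>'"
    using \<phi> by (meson DERIV_isCont continuous_at_imp_continuous_on)+
  have "((\<lambda>t. \<phi> t * z t - \<phi>'' t * w t) has_integral
      (\<phi> pi * v pi - \<phi>' pi * w pi) - (\<phi> (-pi) * v (-pi) - \<phi>' (-pi) * w (-pi))) {-pi..pi}"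
  proof (rule fundamental_theorem_of_calculus_interior_strong[OF *(1)])
    fix t assume t: "t \<in> {-pi<..<pi} - S"
    have "((\<lambda>t. \<phi> t * v t - \<phi>' t * w t) has_real_derivative
        \<phi>' t * v t + \<phi> t * z t - (\<phi>'' t * w t + \<phi>' t * v t)) (at t)"
      using *(4,5)[OF t] by (auto intro!: derivative_eq_intros \<phi>)
    then show "((\<lambda>t. \<phi> t * v t - \<phi>' t * w t) has_vector_derivative \<phi> t * z t - \<phi>'' t * w t) (at t)"
      by (simp add: has_real_derivative_iff_has_vector_derivative[symmetric] algebra_simps)
  qed (auto intro!: continuous_intros c *)
  moreover have "(\<phi> pi * v pi - \<phi>' pi * w pi) - (\<phi> (-pi) * v (-pi) - \<phi>' (-pi) * w (-pi)) = 0"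
    using * per by simp
  moreover have "((\<lambda>t. \<phi>'' t * w t) has_integral integral {-pi..pi} (\<lambda>t. \<phi>'' t * w t)) {-pi..pi}"
    by (intro integrable_integral integrable_continuous_real continuous_intros cont *)
  ultimately show ?thesis
    by (auto dest: has_integral_add)
qed

definition poisson_ds :: "real \<Rightarrow> real \<Rightarrow> real" where
  "poisson_ds s t = (1 - cosh s * cos t) / (cosh s - cos t)\<^sup>2"

definition poisson_dt :: "real \<Rightarrow> real \<Rightarrow> real" where
  "poisson_dt s t = - sinh s * sin t / (cosh s - cos t)\<^sup>2"

definition poisson_ds2 :: "real \<Rightarrow> real \<Rightarrow> real" where
  "poisson_ds2 s t = sinh s * (cosh s * cos t + (cos t)\<^sup>2 - 2) / (cosh s - cos t) ^ 3"

lemma poisson_derivatives: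
  assumes "s > 0"
  shows "((\<lambda>s. poisson s t) has_real_derivative poisson_ds s t) (at s)"
    and "((\<lambda>s. poisson_ds s t) has_real_derivative poisson_ds2 s t) (at s)"
    and "((\<lambda>t. poisson s t) has_real_derivative poisson_dt s t) (at t)"
    and "((\<lambda>t. poisson_dt s t) has_real_derivative - poisson_ds2 s t) (at t)"
proof -
  have ne: "cosh s - cos t \<noteq> 0" using cosh_gt_cos[OF assms, of t] by simp
  have c: "cosh s * cosh s = sinh s * sinh s + 1"
    using hyperbolic_pythagoras[of s] by (simp add: power2_eq_square algebra_simps)
  have d: "sin t * sin t = 1 - cos t * cos t"
    using sin_squared_eq[of t] by (simp add: power2_eq_square)
  show "((\<lambda>s. poisson s t) has_real_derivative poisson_ds s t) (at s)"
    unfolding poisson_def poisson_ds_def using ne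
    by (auto intro!: derivative_eq_intros simp: power2_eq_square c algebra_simps)
  show "((\<lambda>t. poisson s t) has_real_derivative poisson_dt s t) (at t)"
    unfolding poisson_def poisson_dt_def using ne
    by (auto intro!: derivative_eq_intros simp: power2_eq_square)
  show "((\<lambda>s. poisson_ds s t) has_real_derivative poisson_ds2 s t) (at s)"
  proof (rule DERIV_cong)
    show "((\<lambda>s. poisson_ds s t) has_real_derivative
       (- sinh s * cos t * (cosh s - cos t)\<^sup>2
         - (1 - cosh s * cos t) * (2 * (cosh s - cos t) * sinh s)) / ((cosh s - cos t)\<^sup>2 * (cosh s - cos t)\<^sup>2)) (at s)"
      unfolding poisson_ds_def using ne
      by (auto intro!: derivative_eq_intros)
    have "- sinh s * cos t * (cosh s - cos t)\<^sup>2
         - (1 - cosh s * cos t) * (2 * (cosh s - cos t) * sinh s)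
       = sinh s * (cosh s * cos t + (cos t)\<^sup>2 - 2) * (cosh s - cos t)"
      by (simp add: power2_eq_square algebra_simps)
    then show "(- sinh s * cos t * (cosh s - cos t)\<^sup>2
         - (1 - cosh s * cos t) * (2 * (cosh s - cos t) * sinh s)) / ((cosh s - cos t)\<^sup>2 * (cosh s - cos t)\<^sup>2) = poisson_ds2 s t"
      using ne by (simp add: poisson_ds2_def power2_eq_square power3_eq_cube)
  qed
  show "((\<lambda>t. poisson_dt s t) has_real_derivative - poisson_ds2 s t) (at t)"
  proof (rule DERIV_cong)
    show "((\<lambda>t. poisson_dt s t) has_real_derivative
       (- sinh s * cos t * (cosh s - cos t)\<^sup>2
         - (- sinh s * sin t) * (2 * (cosh s - cos t) * sin t)) / ((cosh s - cos t)\<^sup>2 * (cosh s - cos t)\<^sup>2)) (at t)"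
      unfolding poisson_dt_def using ne
      by (auto intro!: derivative_eq_intros simp: divide_simps)
    have "- sinh s * cos t * (cosh s - cos t)\<^sup>2
         - (- sinh s * sin t) * (2 * (cosh s - cos t) * sin t)
       = - sinh s * cos t * (cosh s - cos t)\<^sup>2 + 2 * sinh s * (sin t * sin t) * (cosh s - cos t)"
      by (simp add: mult_ac)
    also have "\<dots> = - (sinh s * (cosh s * cos t + (cos t)\<^sup>2 - 2) * (cosh s - cos t))"
      unfolding d by (simp add: power2_eq_square algebra_simps)
    finally show "(- sinh s * cos t * (cosh s - cos t)\<^sup>2
         - (- sinh s * sin t) * (2 * (cosh s - cos t) * sin t)) / ((cosh s - cos t)\<^sup>2 * (cosh s - cos t)\<^sup>2) = - poisson_ds2 s t"
      using ne by (simp add: poisson_ds2_def power2_eq_square power3_eq_cube)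
  qed
qed

lemma poisson_integral_derivative:
  assumes "s > 0" "continuous_on {-pi..pi} w"
  shows "((\<lambda>s. integral {-pi..pi} (\<lambda>t. poisson s t * w t)) has_real_derivative
      integral {-pi..pi} (\<lambda>t. poisson_ds s t * w t)) (at s)"
    and "((\<lambda>s. integral {-pi..pi} (\<lambda>t. poisson_ds s t * w t)) has_real_derivative
      integral {-pi..pi} (\<lambda>t. poisson_ds2 s t * w t)) (at s)"
proof -
  have ne: "cosh s - cos t \<noteq> 0" if "s > 0" for s t :: real
    using cosh_gt_cos[OF that, of t] by simp
  have w': "continuous_on ({0<..} \<times> {-pi..pi}) (\<lambda>x. w (snd x))"
    by (rule continuous_on_compose2[OF assms(2)]) (auto intro!: continuous_intros)
  have c1: "continuous_on ({0<..} \<times> {-pi..pi}) (\<lambda>(s, t). poisson_ds s t * w t)"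
    unfolding poisson_ds_def split_beta
    by (intro continuous_intros w') (use ne in auto)
  have c2: "continuous_on ({0<..} \<times> {-pi..pi}) (\<lambda>(s, t). poisson_ds2 s t * w t)"
    unfolding poisson_ds2_def split_beta
    by (intro continuous_intros w') (use ne in auto)
  have "((\<lambda>s. integral (cbox (-pi) pi) (\<lambda>t. poisson s t * w t)) has_real_derivative
      integral (cbox (-pi) pi) (\<lambda>t. poisson_ds s t * w t)) (at s within {0<..})"
  proof (rule leibniz_rule_field_derivative)
    show "((\<lambda>s. poisson s t * w t) has_real_derivative poisson_ds s t * w t) (at s within {0<..})"
      if "s \<in> {0<..}" for s t
      using that by (auto intro!: derivative_eq_intros has_field_derivative_at_within[OF poisson_derivatives(1)])
    show "(\<lambda>t. poisson s t * w t) integrable_on cbox (-pi) pi" if "s \<in> {0<..}" for s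
      using that assms by (auto intro!: integrable_continuous_real continuous_intros)
  qed (use c1 assms in auto)
  then show "((\<lambda>s. integral {-pi..pi} (\<lambda>t. poisson s t * w t)) has_real_derivative
      integral {-pi..pi} (\<lambda>t. poisson_ds s t * w t)) (at s)"
    using assms by (simp add: at_within_open[of s "{0<..}"])
  have "((\<lambda>s. integral (cbox (-pi) pi) (\<lambda>t. poisson_ds s t * w t)) has_real_derivative
      integral (cbox (-pi) pi) (\<lambda>t. poisson_ds2 s t * w t)) (at s within {0<..})"
  proof (rule leibniz_rule_field_derivative)
    show "((\<lambda>s. poisson_ds s t * w t) has_real_derivative poisson_ds2 s t * w t) (at s within {0<..})"
      if "s \<in> {0<..}" for s t
      using that by (auto intro!: derivative_eq_intros has_field_derivative_at_within[OF poisson_derivatives(2)])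
    show "(\<lambda>t. poisson_ds s t * w t) integrable_on cbox (-pi) pi" if "s \<in> {0<..}" for s
      unfolding poisson_ds_def cbox_interval
      by (intro integrable_continuous_real continuous_intros assms) (use that ne in auto)
  qed (use c2 assms in auto)
  then show "((\<lambda>s. integral {-pi..pi} (\<lambda>t. poisson_ds s t * w t)) has_real_derivative
      integral {-pi..pi} (\<lambda>t. poisson_ds2 s t * w t)) (at s)"
    using assms by (simp add: at_within_open[of s "{0<..}"])
qed

text \<open>The Poisson kernel is harmonic, so two derivatives in \<open>s\<close> can be traded for minus two
  derivatives in \<open>t\<close>, and Green's formula moves these to \<open>w\<close>.\<close>

lemma poisson_mean_second_derivative:
  assumes "periodic_second_primitive w z"
  obtains D where
    "\<And>s. s > 0 \<Longrightarrow> ((\<lambda>s. poisson_mean s w) has_real_derivative D s) (at s)"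
    "\<And>s. s > 0 \<Longrightarrow> (D has_real_derivative - poisson_mean s z) (at s)"
    "\<And>s. s > 0 \<Longrightarrow> (\<lambda>t. poisson s t * z t) integrable_on {-pi..pi}"
proof
  have w: "continuous_on {-pi..pi} w"
    using assms by (auto simp: periodic_second_primitive_def)
  define D where "D s = integral {-pi..pi} (\<lambda>t. poisson_ds s t * w t) / (2 * pi)" for s
  show "((\<lambda>s. poisson_mean s w) has_real_derivative D s) (at s)" if "s > 0" for s
    unfolding poisson_mean_def D_def
    by (intro DERIV_cdivide poisson_integral_derivative that w)
  have green: "((\<lambda>t. poisson s t * z t) has_integral
      integral {-pi..pi} (\<lambda>t. - poisson_ds2 s t * w t)) {-pi..pi}" if "s > 0" for s
  proof (rule periodic_green[OF assms poisson_derivatives(3,4)[OF that]])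
    have "cosh s \<noteq> cos t" for t using cosh_gt_cos[OF that, of t] by simp
    then show "continuous_on {-pi..pi} (\<lambda>t. - poisson_ds2 s t)"
      unfolding poisson_ds2_def by (intro continuous_intros) auto
  qed (auto simp: poisson_def poisson_dt_def)
  then show "(\<lambda>t. poisson s t * z t) integrable_on {-pi..pi}" if "s > 0" for s
    using that by blast
  have "integral {-pi..pi} (\<lambda>t. poisson_ds2 s t * w t) / (2 * pi) = - poisson_mean s z" if "s > 0" for s
    using integral_unique[OF green[OF that]] by (simp add: poisson_mean_def)
  then show "(D has_real_derivative - poisson_mean s z) (at s)" if "s > 0" for s
    unfolding D_def using DERIV_cdivide[OF poisson_integral_derivative(2)[OF that w], of "2 * pi"] that
    by simp
qed

text \<open>A convex function that tends to \<open>0\<close> at infinity cannot increase anywhere.\<close>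

lemma convex_tendsto_0_nonneg:
  fixes H :: "real \<Rightarrow> real"
  assumes H': "\<And>s. s > 0 \<Longrightarrow> (H has_real_derivative H' s) (at s)"
    and H'': "\<And>s. s > 0 \<Longrightarrow> (H' has_real_derivative H'' s) (at s)"
    and nonneg: "\<And>s. s > 0 \<Longrightarrow> H'' s \<ge> 0"
    and lim: "(H \<longlongrightarrow> 0) at_top" and "s > 0"
  shows "H s \<ge> 0"
proof -
  have mono: "H' a \<le> H' b" if "0 < a" "a \<le> b" for a b
    using that by (intro DERIV_nonneg_imp_nondecreasing[OF that(2)])
      (meson H'' nonneg less_le_trans)
  have tangent: "H a + H' a * (b - a) \<le> H b" if ab: "0 < a" "a < b" for a b
  proof -
    obtain c where "a < c" "c < b" "H b - H a = (b - a) * H' c"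
      using MVT2[of a b H H'] H' ab by force
    moreover have "(b - a) * H' a \<le> (b - a) * H' c"
      using mono[of a c] calculation ab by (intro mult_left_mono) auto
    ultimately show ?thesis by (simp add: algebra_simps)
  qed
  have decr: "H' a \<le> 0" if "0 < a" for a
  proof (rule ccontr)
    assume "\<not> H' a \<le> 0"
    then have "filterlim (\<lambda>b. H a + H' a * (- a + b)) at_top at_top"
      by (intro filterlim_tendsto_add_at_top[OF tendsto_const]
          filterlim_tendsto_pos_mult_at_top[OF tendsto_const] filterlim_ident) auto
    then have "filterlim H at_top at_top"
      by (rule filterlim_at_top_mono)
         (use tangent[OF that] in \<open>auto intro!: eventually_mono[OF eventually_gt_at_top[of a]]\<close>)
    with lim show False
      using not_tendsto_and_filterlim_at_infinity[of at_top H 0] filterlim_at_top_imp_at_infinity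
      by force
  qed
  have "H b \<le> H s" if "b > s" for b
    using that decr H' \<open>s > 0\<close>
    by (intro DERIV_nonpos_imp_nonincreasing[of s b H]) (meson less_imp_le less_le_trans)+
  then have "0 \<le> H s"
    by (intro tendsto_upperbound[OF lim eventually_mono[OF eventually_gt_at_top[of s]]]) auto
  then show ?thesis .
qed

section \<open>The extremal function\<close>

lemma cos_mult_zeros_finite:
  assumes "n \<ge> 1"
  shows "finite {t \<in> {-pi..pi}. cos (real n * t) = 0}"
proof -
  have "{t \<in> {-pi..pi}. cos (real n * t) = 0}
      \<subseteq> (\<lambda>i. of_int i * (pi / 2) / real n) ` {- 2 * int n .. 2 * int n}"
  proof safe
    fix t assume t: "t \<in> {-pi..pi}" and "cos (real n * t) = 0"
    then obtain i :: int where i: "real n * t = of_int i * (pi / 2)"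
      by (auto simp: cos_zero_iff_int)
    have "\<bar>real n * t\<bar> \<le> real n * pi"
      using t by (auto simp: abs_mult intro!: mult_left_mono)
    then have "\<bar>of_int i * (pi / 2)\<bar> \<le> real n * pi" unfolding i .
    then have "\<bar>real_of_int i\<bar> * pi \<le> (2 * real n) * pi" by (simp add: abs_mult)
    then have "\<bar>real_of_int i\<bar> \<le> 2 * real n" by simp
    then have "\<bar>i\<bar> \<le> 2 * int n" by linarith
    then have "i \<in> {- 2 * int n .. 2 * int n}" by auto
    moreover have "t = of_int i * (pi / 2) / real n" using i assms by (simp add: field_simps)
    ultimately show "t \<in> (\<lambda>i. of_int i * (pi / 2) / real n) ` {- 2 * int n .. 2 * int n}" by blast
  qed
  then show ?thesis by (rule finite_subset) simp
qed

text \<open>On \<open>\<bar>t\<bar> < \<pi> / (2 n)\<close> this is \<open>cos (\<nu> t) / cos (\<nu> \<pi> / (2 n)) - 1\<close>, continued by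
  \<open>w (t + \<pi> / n) = - w t\<close>; the triangle wave \<open>arcsin (sin (n t)) / n\<close> does the folding.
  It solves \<open>w'' = - \<nu>\<^sup>2 (w + sgn (cos (n t)))\<close>. Thus \<open>f = w + sgn (cos (n t))\<close> and
  \<open>F = w / \<nu>\<^sup>2\<close> satisfy \<open>F'' = - f\<close> and \<open>f - \<nu>\<^sup>2 F = \<plusminus> 1\<close>, and
  \<open>f 0 = 1 / cos (\<nu> \<pi> / (2 n))\<close>: this is the (discontinuous) extremal pair of the inequality
  proved below.\<close>

definition extremal :: "nat \<Rightarrow> real \<Rightarrow> real \<Rightarrow> real" where
  "extremal n \<nu> t = sgn (cos (real n * t)) *
     (cos (\<nu> / real n * arcsin (sin (real n * t))) / cos (\<nu> * pi / (2 * real n)) - 1)"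

lemma extremal_0: "n \<ge> 1 \<Longrightarrow> extremal n \<nu> 0 = 1 / cos (\<nu> * pi / (2 * real n)) - 1"
  by (simp add: extremal_def)

lemma continuous_sgn_mult:
  fixes f g :: "real \<Rightarrow> real"
  assumes "isCont f x" "isCont g x" "f x = 0 \<Longrightarrow> g x = 0"
  shows "isCont (\<lambda>x. sgn (f x) * g x) x"
proof (cases "f x = 0")
  case True
  have "((\<lambda>x. sgn (f x) * g x) \<longlongrightarrow> 0) (at x)"
  proof (rule Lim_null_comparison)
    show "eventually (\<lambda>x. norm (sgn (f x) * g x) \<le> \<bar>g x\<bar>) (at x)"
      by (auto simp: abs_mult sgn_if)
    show "((\<lambda>x. \<bar>g x\<bar>) \<longlongrightarrow> 0) (at x)"
      using assms(2,3) True by (auto simp: isCont_def intro: tendsto_rabs_zero)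
  qed
  then show ?thesis using True assms(3) by (simp add: isCont_def)
next
  case False
  then show ?thesis by (intro continuous_intros assms)
qed

lemma abs_sin_eq_1: "cos x = 0 \<Longrightarrow> sin x = 1 \<or> sin x = - (1::real)"
  using sin_squared_eq[of x] by (simp add: power2_eq_1_iff)

lemma extremal_continuous:
  assumes "n \<ge> 1" "cos (\<nu> * pi / (2 * real n)) > 0"
  shows "continuous_on A (extremal n \<nu>)"
proof -
  have arc: "continuous_on UNIV (\<lambda>t. arcsin (sin (real n * t)))"
    by (intro continuous_intros) auto
  have "isCont (extremal n \<nu>) t" for t
    unfolding extremal_def
  proof (rule continuous_sgn_mult)
    show "isCont (\<lambda>t. cos (\<nu> / real n * arcsin (sin (real n * t))) / cos (\<nu> * pi / (2 * real n)) - 1) t"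
      using arc assms by (intro continuous_intros) (auto simp: continuous_on_eq_continuous_at)
  next
    assume "cos (real n * t) = 0"
    then have "arcsin (sin (real n * t)) = pi / 2 \<or> arcsin (sin (real n * t)) = - (pi / 2)"
      using abs_sin_eq_1 by fastforce
    moreover have "cos (\<nu> / real n * a) / cos (\<nu> * pi / (2 * real n)) - 1 = 0"
      if "a = pi / 2 \<or> a = - (pi / 2)" for a
    proof -
      have "\<nu> / real n * a = \<nu> * pi / (2 * real n) \<or> \<nu> / real n * a = - (\<nu> * pi / (2 * real n))"
        using that by (elim disjE) (simp_all only: times_divide_eq_right times_divide_eq_left mult_minus_right, simp_all add: mult.commute)
      then have "cos (\<nu> / real n * a) = cos (\<nu> * pi / (2 * real n))"
        by (metis cos_minus)
      then show ?thesis using assms by simp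
    qed
    ultimately show "cos (\<nu> / real n * arcsin (sin (real n * t))) / cos (\<nu> * pi / (2 * real n)) - 1 = 0"
      by blast
  qed auto
  then show ?thesis by (simp add: continuous_at_imp_continuous_on)
qed

lemma extremal_even: "extremal n \<nu> (- t) = extremal n \<nu> t"
  by (simp add: extremal_def arcsin_minus)

lemma extremal_antiperiodic:
  assumes "n \<ge> 1"
  shows "extremal n \<nu> (t + pi / real n) = - extremal n \<nu> t"
proof -
  have "real n * (t + pi / real n) = real n * t + pi" using assms by (simp add: distrib_left)
  then show ?thesis by (simp add: extremal_def arcsin_minus sgn_minus)
qed

lemma extremal_periodic: "extremal n \<nu> (t + 2 * pi) = extremal n \<nu> t"
proof -
  have "real n * (t + 2 * pi) = real n * t + 2 * real n * pi" by (simp add: algebra_simps)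
  moreover have "sin (x + 2 * real n * pi) = sin x" "cos (x + 2 * real n * pi) = cos x" for x
    by (simp_all add: sin_add cos_add sin_2npi cos_2npi)
  ultimately show ?thesis by (simp add: extremal_def)
qed

text \<open>Translation by \<open>\<pi> / n\<close> rotates the \<open>j\<close>-th Fourier coefficient by the angle \<open>j \<pi> / n\<close>,
  which is not \<open>\<pi>\<close> for \<open>j < n\<close>, and changes the sign of an antiperiodic function.\<close>

lemma extremal_orthogonal_below:
  assumes "n \<ge> 1" "cos (\<nu> * pi / (2 * real n)) > 0"
  shows "orthogonal_below n (extremal n \<nu>)"
  unfolding orthogonal_below_def
proof (intro allI impI)
  fix j assume "j < n"
  let ?w = "extremal n \<nu>"
  note cont = extremal_continuous[OF assms]
  define I where "I = integral {-pi..pi} (\<lambda>t. cos (real j * t) * ?w t)"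
  define \<theta> where "\<theta> = real j * (pi / real n)"
  have sin0: "integral {-pi..pi} (\<lambda>t. sin (real j * t) * ?w t) = 0"
  proof -
    have "integral {-pi..pi} (\<lambda>t. sin (real j * - t) * ?w (- t))
        = integral {-pi..pi} (\<lambda>t. sin (real j * t) * ?w t)"
      using Henstock_Kurzweil_Integration.integral_reflect_real[of pi "-pi" "\<lambda>t. sin (real j * t) * ?w t"]
      by (simp only: minus_minus)
    then show ?thesis by (simp add: extremal_even)
  qed
  have per: "cos (real j * (t + 2 * pi)) * ?w (t + 2 * pi) = cos (real j * t) * ?w t" for t
  proof -
    have "real j * (t + 2 * pi) = real j * t + 2 * real j * pi" by (simp add: algebra_simps)
    then show ?thesis by (simp add: extremal_periodic cos_add sin_2npi cos_2npi)
  qed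
  have "I = integral {-pi..pi} (\<lambda>t. cos (real j * (pi / real n + t)) * ?w (pi / real n + t))"
    unfolding I_def
    by (rule integral_period_shift[symmetric]) (intro continuous_intros cont, rule per)
  also have "\<dots> = integral {-pi..pi} (\<lambda>t. sin \<theta> * (sin (real j * t) * ?w t) - cos \<theta> * (cos (real j * t) * ?w t))"
  proof (rule arg_cong[of _ _ "integral _"], rule ext)
    fix t
    have "real j * (pi / real n + t) = \<theta> + real j * t" by (simp add: \<theta>_def algebra_simps)
    then show "cos (real j * (pi / real n + t)) * ?w (pi / real n + t)
        = sin \<theta> * (sin (real j * t) * ?w t) - cos \<theta> * (cos (real j * t) * ?w t)"
      using extremal_antiperiodic[OF assms(1), of \<nu> t] by (simp add: cos_add add.commute algebra_simps)
  qed
  also have "\<dots> = - cos \<theta> * I"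
    using sin0 by (subst integral_diff)
      (auto intro!: integrable_continuous_real continuous_intros cont simp: I_def)
  finally have "(1 + cos \<theta>) * I = 0" by (simp add: algebra_simps)
  moreover have "1 + cos \<theta> > 0"
  proof -
    have "0 \<le> \<theta>" "\<theta> < pi" using \<open>j < n\<close> by (auto simp: \<theta>_def field_simps)
    then show ?thesis using cos_monotone_0_pi[of \<theta> pi] by simp
  qed
  ultimately show "I = 0" by simp
qed

lemma sgn_has_derivative_0:
  fixes f :: "real \<Rightarrow> real"
  assumes "continuous_on UNIV f" "f x \<noteq> 0"
  shows "((\<lambda>x. sgn (f x)) has_real_derivative 0) (at x)"
proof (rule has_field_derivative_transform_within_open)
  show "((\<lambda>y. sgn (f x)) has_real_derivative 0) (at x)" by simp
  show "open {y. 0 < f x * f y}"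
    by (intro open_Collect_less continuous_intros assms)
  show "x \<in> {y. 0 < f x * f y}" using assms(2) by (simp add: power2_eq_square[symmetric])
  show "sgn (f x) = sgn (f y)" if "y \<in> {y. 0 < f x * f y}" for y
    using that by (auto simp: sgn_if zero_less_mult_iff)
qed

lemma triangle_wave_derivative:
  assumes "cos (real n * t) \<noteq> 0"
  shows "((\<lambda>t. arcsin (sin (real n * t))) has_real_derivative real n * sgn (cos (real n * t))) (at t)"
proof -
  have "(sin (real n * t))\<^sup>2 \<noteq> 1"
    using assms sin_squared_eq[of "real n * t"] by simp
  then have "sin (real n * t) \<noteq> 1" "sin (real n * t) \<noteq> -1"
    by (metis one_power2) (metis \<open>(sin (real n * t))\<^sup>2 \<noteq> 1\<close> one_power2 power2_minus)
  then have range: "-1 < sin (real n * t)" "sin (real n * t) < 1"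
    using sin_ge_minus_one[of "real n * t"] sin_le_one[of "real n * t"]
    by (auto simp: less_le)
  have root: "sqrt (1 - (sin (real n * t))\<^sup>2) = \<bar>cos (real n * t)\<bar>"
    by (simp add: cos_squared_eq[symmetric])
  have "((\<lambda>t. arcsin (sin (real n * t))) has_real_derivative
      inverse (sqrt (1 - (sin (real n * t))\<^sup>2)) * (cos (real n * t) * real n)) (at t)"
    by (rule DERIV_chain2[where g = "\<lambda>t. sin (real n * t)", OF DERIV_arcsin[OF range]]) (auto intro!: derivative_eq_intros)
  then show ?thesis
    unfolding root by (rule DERIV_cong) (use assms in \<open>auto simp: sgn_if field_simps\<close>)
qed

lemma extremal_second_primitive:
  assumes "n \<ge> 1" "cos (\<nu> * pi / (2 * real n)) > 0"
  shows "periodic_second_primitive (extremal n \<nu>)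
     (\<lambda>t. - \<nu>\<^sup>2 * (extremal n \<nu> t + sgn (cos (real n * t))))"
  unfolding periodic_second_primitive_def
proof (intro exI conjI ballI)
  define c where "c = cos (\<nu> * pi / (2 * real n))"
  have c: "c > 0" using assms by (simp add: c_def)
  define v where "v t = - \<nu> * sin (\<nu> / real n * arcsin (sin (real n * t))) / c" for t
  show "finite {t \<in> {-pi..pi}. cos (real n * t) = 0}"
    by (rule cos_mult_zeros_finite[OF assms(1)])
  show "continuous_on {-pi..pi} (extremal n \<nu>)"
    by (rule extremal_continuous[OF assms])
  show "continuous_on {-pi..pi} v"
    unfolding v_def using c by (intro continuous_intros) auto
  show "extremal n \<nu> (-pi) = extremal n \<nu> pi"
    using extremal_periodic[of n \<nu> "-pi"] by simp
  show "v (-pi) = v pi" by (simp add: v_def)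
  fix t assume "t \<in> {-pi<..<pi} - {t \<in> {-pi..pi}. cos (real n * t) = 0}"
  then have t: "cos (real n * t) \<noteq> 0" by auto
  then have sgn2: "sgn (cos (real n * t)) * sgn (cos (real n * t)) = 1" by (simp add: sgn_if)
  note derivs = triangle_wave_derivative[OF t]
    sgn_has_derivative_0[of "\<lambda>t. cos (real n * t)", OF _ t]
  show "(extremal n \<nu> has_real_derivative v t) (at t)"
  proof (rule DERIV_cong)
    show "(extremal n \<nu> has_real_derivative
        sgn (cos (real n * t)) * (- sin (\<nu> / real n * arcsin (sin (real n * t)))
          * (\<nu> / real n * (real n * sgn (cos (real n * t)))) / c)) (at t)"
      unfolding extremal_def c_def[symmetric]
      by (rule derivative_eq_intros derivs continuous_intros refl | use c in \<open>simp; fail\<close>)+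
    show "sgn (cos (real n * t)) * (- sin (\<nu> / real n * arcsin (sin (real n * t)))
          * (\<nu> / real n * (real n * sgn (cos (real n * t)))) / c) = v t"
      using assms(1) sgn2 by (simp add: v_def)
  qed
  show "(v has_real_derivative - \<nu>\<^sup>2 * (extremal n \<nu> t + sgn (cos (real n * t)))) (at t)"
  proof (rule DERIV_cong)
    show "(v has_real_derivative - \<nu> * (cos (\<nu> / real n * arcsin (sin (real n * t)))
          * (\<nu> / real n * (real n * sgn (cos (real n * t))))) / c) (at t)"
      unfolding v_def
      by (rule derivative_eq_intros derivs continuous_intros refl | use c in \<open>simp; fail\<close>)+
    show "- \<nu> * (cos (\<nu> / real n * arcsin (sin (real n * t)))
          * (\<nu> / real n * (real n * sgn (cos (real n * t))))) / c
        = - \<nu>\<^sup>2 * (extremal n \<nu> t + sgn (cos (real n * t)))"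
      using assms(1) by (simp add: extremal_def c_def[symmetric] power2_eq_square right_diff_distrib)
  qed
qed

text \<open>The square wave is \<open>- w'' / \<nu>\<^sup>2 - w\<close>, so by Green's formula it inherits the orthogonality
  of \<open>w\<close>. The Poisson kernel may therefore be replaced by
  \<open>poisson s t * cos (n t) / cosh (n s)\<close>, whose product with the square wave is its
  absolute value.\<close>

lemma poisson_mean_square_wave:
  assumes "n \<ge> 1" "cos (\<nu> * pi / (2 * real n)) > 0" "\<nu> \<noteq> 0" "s > 0"
  shows "poisson_mean s (\<lambda>t. \<nu>\<^sup>2 * (extremal n \<nu> t + sgn (cos (real n * t))))
    = \<nu>\<^sup>2 * (poisson_norm n s + poisson_mean s (extremal n \<nu>))"
proof -
  let ?w = "extremal n \<nu>" and ?\<sigma> = "\<lambda>t. sgn (cos (real n * t))"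
  note cont = extremal_continuous[OF assms(1,2)]
  note prim = extremal_second_primitive[OF assms(1,2)]
  have split: "(\<lambda>t. \<phi> t * ?\<sigma> t) integrable_on {-pi..pi} \<and>
      integral {-pi..pi} (\<lambda>t. \<phi> t * (\<nu>\<^sup>2 * (?w t + ?\<sigma> t)))
      = \<nu>\<^sup>2 * (integral {-pi..pi} (\<lambda>t. \<phi> t * ?w t) + integral {-pi..pi} (\<lambda>t. \<phi> t * ?\<sigma> t))"
    if "continuous_on {-pi..pi} \<phi>" "(\<lambda>t. \<phi> t * (- \<nu>\<^sup>2 * (?w t + ?\<sigma> t))) integrable_on {-pi..pi}" for \<phi>
  proof -
    have w: "(\<lambda>t. \<phi> t * ?w t) integrable_on {-pi..pi}"
      by (intro integrable_continuous_real continuous_intros that cont)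
    have "(\<lambda>t. - (1 / \<nu>\<^sup>2) * (\<phi> t * (- \<nu>\<^sup>2 * (?w t + ?\<sigma> t))) - \<phi> t * ?w t) integrable_on {-pi..pi}"
      by (intro integrable_diff integrable_on_mult_right that(2) w)
    moreover have "(\<lambda>t. - (1 / \<nu>\<^sup>2) * (\<phi> t * (- \<nu>\<^sup>2 * (?w t + ?\<sigma> t))) - \<phi> t * ?w t) = (\<lambda>t. \<phi> t * ?\<sigma> t)"
      using assms(3) by (simp add: fun_eq_iff field_simps)
    ultimately have \<sigma>: "(\<lambda>t. \<phi> t * ?\<sigma> t) integrable_on {-pi..pi}" by simp
    have "integral {-pi..pi} (\<lambda>t. \<phi> t * (\<nu>\<^sup>2 * (?w t + ?\<sigma> t)))
        = integral {-pi..pi} (\<lambda>t. \<nu>\<^sup>2 * (\<phi> t * ?w t + \<phi> t * ?\<sigma> t))"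
      by (simp add: algebra_simps)
    also have "\<dots> = \<nu>\<^sup>2 * (integral {-pi..pi} (\<lambda>t. \<phi> t * ?w t) + integral {-pi..pi} (\<lambda>t. \<phi> t * ?\<sigma> t))"
      using integral_add[OF w \<sigma>] by simp
    finally show ?thesis using \<sigma> by simp
  qed
  have poisson_int: "(\<lambda>t. poisson s t * (- \<nu>\<^sup>2 * (?w t + ?\<sigma> t))) integrable_on {-pi..pi}"
    using poisson_mean_second_derivative[OF prim] assms(4) by metis
  note poisson_split = split[OF poisson_continuous[OF assms(4)] poisson_int]
  have cos_\<sigma>: "(\<lambda>t. cos (real j * t) * ?\<sigma> t) integrable_on {-pi..pi} \<and>
      integral {-pi..pi} (\<lambda>t. cos (real j * t) * ?\<sigma> t) = 0" if "j < n" for j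
  proof -
    have green: "((\<lambda>t. cos (real j * t) * (- \<nu>\<^sup>2 * (?w t + ?\<sigma> t))) has_integral
        integral {-pi..pi} (\<lambda>t. - (real j)\<^sup>2 * cos (real j * t) * ?w t)) {-pi..pi}"
      by (rule periodic_green[OF prim, where \<phi>' = "\<lambda>t. - real j * sin (real j * t)"])
         (auto intro!: derivative_eq_intros continuous_intros simp: power2_eq_square)
    have w0: "integral {-pi..pi} (\<lambda>t. cos (real j * t) * ?w t) = 0"
      using extremal_orthogonal_below[OF assms(1,2)] that by (simp add: orthogonal_below_def)
    have "integral {-pi..pi} (\<lambda>t. - (real j)\<^sup>2 * cos (real j * t) * ?w t) = 0"
      using w0 by (simp add: mult.assoc)
    with green have "((\<lambda>t. - (cos (real j * t) * (- \<nu>\<^sup>2 * (?w t + ?\<sigma> t)))) has_integral - 0) {-pi..pi}"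
      by (intro has_integral_neg) simp
    then have "integral {-pi..pi} (\<lambda>t. cos (real j * t) * (\<nu>\<^sup>2 * (?w t + ?\<sigma> t))) = 0"
      by (intro integral_unique) simp
    moreover have "continuous_on {-pi..pi} (\<lambda>t. cos (real j * t))" by (intro continuous_intros)
    ultimately show ?thesis
      using split[of "\<lambda>t. cos (real j * t)"] green w0 assms(3) by (auto simp: has_integral_integrable)
  qed
  have interpolant: "((\<lambda>t. poisson_interpolant n s t * ?\<sigma> t) has_integral 0) {-pi..pi}"
  proof -
    have expand: "(\<lambda>t. poisson_interpolant n s t * ?\<sigma> t) =
      (\<lambda>t. sinh (real n * s) * (cos (real 0 * t) * ?\<sigma> t)
        + (\<Sum>j=1..<n. 2 * sinh (real (n - j) * s) * (cos (real j * t) * ?\<sigma> t)))"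
      by (auto simp: poisson_interpolant_def fun_eq_iff algebra_simps sum_distrib_left sum_distrib_right)
    have *: "((\<lambda>t. c * (cos (real j * t) * ?\<sigma> t)) has_integral c * 0) {-pi..pi}" if "j < n" for c j
      using cos_\<sigma>[OF that] by (intro has_integral_mult_right) (simp add: has_integral_iff)
    have "((\<lambda>t. sinh (real n * s) * (cos (real 0 * t) * ?\<sigma> t)
        + (\<Sum>j=1..<n. 2 * sinh (real (n - j) * s) * (cos (real j * t) * ?\<sigma> t)))
        has_integral sinh (real n * s) * 0 + (\<Sum>j=1..<n. 2 * sinh (real (n - j) * s) * 0)) {-pi..pi}"
      by (intro has_integral_add has_integral_sum *) (use assms(1) in auto)
    then show ?thesis unfolding expand by simp
  qed
  have "integral {-pi..pi} (\<lambda>t. poisson s t * \<bar>cos (real n * t)\<bar>)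
      = integral {-pi..pi} (\<lambda>t. poisson_interpolant n s t * ?\<sigma> t + poisson s t * \<bar>cos (real n * t)\<bar>)"
    using interpolant assms(4)
    by (subst integral_add) (auto intro!: integrable_continuous_real continuous_intros simp: has_integral_iff)
  also have "\<dots> = integral {-pi..pi} (\<lambda>t. cosh (real n * s) * (poisson s t * ?\<sigma> t))"
    by (rule arg_cong[of _ _ "integral _"], rule ext)
       (simp add: mult.assoc[symmetric] poisson_interpolation[OF assms(4)] distrib_right,
        simp add: abs_sgn mult.assoc)
  finally have "poisson_norm n s = integral {-pi..pi} (\<lambda>t. poisson s t * ?\<sigma> t) / (2 * pi)"
    by (simp add: poisson_norm_def)
  then show ?thesis
    using poisson_split by (simp add: poisson_mean_def add_divide_distrib distrib_left add.commute)
qed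

section \<open>A perturbed Bohr-Favard inequality\<close>

text \<open>The Bohr-Favard setting: \<open>F'' = - f\<close>, both periodic and orthogonal to the trigonometric
  polynomials of degree below \<open>n\<close>.\<close>

locale periodic_pair =
  fixes n :: nat and f F :: "real \<Rightarrow> real"
  assumes n: "n \<ge> 1"
    and f_cont: "continuous_on UNIV f" and f_per: "\<And>x. f (x + 2 * pi) = f x"
    and F_per: "\<And>x. F (x + 2 * pi) = F x"
    and primitive: "\<exists>V. (\<forall>x. (F has_real_derivative V x) (at x)) \<and>
      (\<forall>x. (V has_real_derivative - f x) (at x)) \<and> (\<forall>x. V (x + 2 * pi) = V x)"
    and f_orth: "\<And>x. orthogonal_below n (\<lambda>t. f (x + t))"
    and F_orth: "\<And>x. orthogonal_below n (\<lambda>t. F (x + t))"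
begin

lemma F_cont: "continuous_on UNIV F"
  using primitive by (meson DERIV_isCont continuous_at_imp_continuous_on)

lemma translates_cont: "continuous_on A (\<lambda>t. f (x + t))" "continuous_on A (\<lambda>t. F (x + t))"
  by (auto intro!: continuous_on_compose2[OF f_cont] continuous_on_compose2[OF F_cont] continuous_intros)

lemma translate_second_primitive: "periodic_second_primitive (\<lambda>t. F (x + t)) (\<lambda>t. - f (x + t))"
proof -
  obtain V where V: "\<And>x. (F has_real_derivative V x) (at x)" "\<And>x. (V has_real_derivative - f x) (at x)"
      "\<And>x. V (x + 2 * pi) = V x"
    using primitive by blast
  have derivs: "((\<lambda>t. F (x + t)) has_real_derivative V (x + t)) (at t)"
      "((\<lambda>t. V (x + t)) has_real_derivative - f (x + t)) (at t)" for t
    by (auto intro!: derivative_eq_intros DERIV_chain2[OF V(1), THEN DERIV_cong]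
        DERIV_chain2[OF V(2), THEN DERIV_cong])
  show ?thesis
    unfolding periodic_second_primitive_def
  proof (intro exI conjI ballI)
    show "continuous_on {-pi..pi} (\<lambda>t. V (x + t))"
      using derivs(2) by (meson DERIV_isCont continuous_at_imp_continuous_on)
    show "F (x + -pi) = F (x + pi)" "V (x + -pi) = V (x + pi)"
      using F_per[of "x - pi"] V(3)[of "x - pi"] by (simp_all add: algebra_simps)
  qed (use derivs translates_cont in auto)
qed

text \<open>The perturbation \<open>F \<mapsto> (\<Sum>i\<in>I. d i * F (\<cdot> + y i))\<close> commutes with Poisson means
  and has norm at most \<open>\<nu>\<^sup>2\<close>. Put \<open>N = poisson_norm n\<close> and let \<open>Z\<close> be the Poisson mean
  of the extremal function at \<open>0\<close>, so that \<open>Z'' = \<nu>\<^sup>2 (N + Z)\<close>. A bound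
  \<open>\<bar>P f\<bar> \<le> M (N + Z) + C exp (- n s)\<close> for all Poisson means of \<open>f\<close>
  integrates twice, from infinity, to
  \<open>\<bar>P F\<bar> \<le> M Z / \<nu>\<^sup>2 + C exp (- n s) / n\<^sup>2\<close>, and the hypothesis returns the first bound with
  \<open>C\<close> replaced by \<open>C (\<nu> / n)\<^sup>2\<close>. Hence \<open>C\<close> can be taken to be \<open>0\<close>, and the limit at
  \<open>s = 0\<close> is the claim.\<close>

lemma perturbed_bohr_favard:
  fixes d :: "'i \<Rightarrow> real" and y :: "'i \<Rightarrow> real"
  assumes \<nu>: "0 < \<nu>" "\<nu> < real n"
    and I: "finite I" "(\<Sum>i\<in>I. \<bar>d i\<bar>) \<le> \<nu>\<^sup>2"
    and M: "\<And>x. \<bar>f x - (\<Sum>i\<in>I. d i * F (x + y i))\<bar> \<le> M"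
  shows "\<bar>f x\<bar> \<le> M / cos (\<nu> * pi / (2 * real n))"
proof -
  let ?w = "extremal n \<nu>"
  define c where "c = cos (\<nu> * pi / (2 * real n))"
  have "\<nu> * pi / (2 * real n) < pi / 2" "0 < \<nu> * pi / (2 * real n)"
    using \<nu> by (auto simp: field_simps)
  then have c: "c > 0"
    unfolding c_def by (intro cos_gt_zero_pi) auto
  note c' = c[unfolded c_def]
  obtain Bf where Bf: "\<And>x. \<bar>f x\<bar> \<le> Bf" using continuous_periodic_bounded[OF f_cont f_per] by blast
  obtain BF where BF: "\<And>x. \<bar>F x\<bar> \<le> BF" using continuous_periodic_bounded[OF F_cont F_per] by blast
  obtain Bw where Bw: "\<And>x. \<bar>?w x\<bar> \<le> Bw"
    using continuous_periodic_bounded[OF extremal_continuous[OF n c'] extremal_periodic] by blast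
  have "M \<ge> 0" "Bf \<ge> 0" "Bw \<ge> 0" using M[of 0] Bf[of 0] Bw[of 0] by linarith+
  define K where "K x s = poisson_mean s (\<lambda>t. f (x + t))" for x s
  define L where "L x s = poisson_mean s (\<lambda>t. F (x + t))" for x s
  define Z where "Z s = poisson_mean s ?w" for s
  define g where "g x = f x - (\<Sum>i\<in>I. d i * F (x + y i))" for x

  have g_integral: "integral {-pi..pi} (\<lambda>t. \<phi> t * g (x + t))
      = integral {-pi..pi} (\<lambda>t. \<phi> t * f (x + t))
        - (\<Sum>i\<in>I. d i * integral {-pi..pi} (\<lambda>t. \<phi> t * F (x + y i + t)))"
    if "continuous_on {-pi..pi} \<phi>" for \<phi> x
  proof -
    have F_int: "(\<lambda>t. d i * (\<phi> t * F (x + y i + t))) integrable_on {-pi..pi}" for i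
      by (intro integrable_continuous_real continuous_intros that translates_cont)
    have f_int: "(\<lambda>t. \<phi> t * f (x + t)) integrable_on {-pi..pi}"
      by (intro integrable_continuous_real continuous_intros that translates_cont)
    have expand: "(\<lambda>t. \<phi> t * g (x + t))
        = (\<lambda>t. \<phi> t * f (x + t) - (\<Sum>i\<in>I. d i * (\<phi> t * F (x + y i + t))))"
      by (auto simp: g_def fun_eq_iff algebra_simps sum_distrib_left)
    show ?thesis
      unfolding expand
      by (subst integral_diff)
         (auto intro!: f_int integrable_sum F_int I simp: integral_sum[OF I(1) F_int])
  qed
  have g_cont: "continuous_on A (\<lambda>t. g (x + t))" for A x
  proof -
    have expand: "(\<lambda>t. g (x + t)) = (\<lambda>t. f (x + t) - (\<Sum>i\<in>I. d i * F ((x + y i) + t)))"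
      by (simp add: g_def add_ac)
    show ?thesis unfolding expand by (intro continuous_intros translates_cont)
  qed
  have g_orth: "orthogonal_below n (\<lambda>t. g (x + t))" for x
    using f_orth F_orth
    by (auto simp: orthogonal_below_def g_integral continuous_intros)
  have g_mean: "poisson_mean s (\<lambda>t. g (x + t)) = K x s - (\<Sum>i\<in>I. d i * L (x + y i) s)" if "s > 0" for s x
    using that
    by (simp add: poisson_mean_def K_def L_def g_integral poisson_continuous diff_divide_distrib sum_divide_distrib)

  have K_step: "\<bar>K x s\<bar> \<le> M * poisson_norm n s + \<nu>\<^sup>2 * B"
    if "s > 0" and B: "\<And>x. \<bar>L x s\<bar> \<le> B" for s x B
  proof -
    have "\<bar>K x s\<bar> = \<bar>poisson_mean s (\<lambda>t. g (x + t)) + (\<Sum>i\<in>I. d i * L (x + y i) s)\<bar>"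
      by (simp add: g_mean[OF that(1)])
    also have "\<dots> \<le> \<bar>poisson_mean s (\<lambda>t. g (x + t))\<bar> + (\<Sum>i\<in>I. \<bar>d i * L (x + y i) s\<bar>)"
      by (rule order_trans[OF abs_triangle_ineq add_left_mono[OF sum_abs]])
    also have "\<bar>poisson_mean s (\<lambda>t. g (x + t))\<bar> \<le> M * poisson_norm n s"
      by (rule poisson_mean_le_norm[OF that(1) g_orth g_cont]) (unfold g_def, rule M)
    also have "(\<Sum>i\<in>I. \<bar>d i * L (x + y i) s\<bar>) \<le> (\<Sum>i\<in>I. \<bar>d i\<bar> * B)"
      by (intro sum_mono) (auto simp: abs_mult intro!: mult_left_mono B)
    also have "\<dots> = (\<Sum>i\<in>I. \<bar>d i\<bar>) * B" by (simp add: sum_distrib_right)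
    also have "\<dots> \<le> \<nu>\<^sup>2 * B"
      using B[of 0] by (intro mult_right_mono I) auto
    finally show ?thesis by simp
  qed

  have exp_norm: "poisson_norm n s \<le> 2 * exp (- real n * s)" if "s > 0" for s
  proof -
    have "exp (real n * s) \<le> 2 * cosh (real n * s)"
      by (simp add: cosh_field_def)
    then have "1 / cosh (real n * s) \<le> 2 * exp (- real n * s)"
      by (simp add: exp_minus divide_simps mult.commute)
    then show ?thesis using poisson_norm_bounds(2)[OF that, of n] by linarith
  qed

  obtain Z' where Z': "\<And>s. s > 0 \<Longrightarrow> (Z has_real_derivative Z' s) (at s)"
      "\<And>s. s > 0 \<Longrightarrow> (Z' has_real_derivative \<nu>\<^sup>2 * (poisson_norm n s + Z s)) (at s)"
  proof -
    obtain D where D: "\<And>s. s > 0 \<Longrightarrow> (Z has_real_derivative D s) (at s)"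
      "\<And>s. s > 0 \<Longrightarrow> (D has_real_derivative
          - poisson_mean s (\<lambda>t. - \<nu>\<^sup>2 * (?w t + sgn (cos (real n * t))))) (at s)"
      using poisson_mean_second_derivative[OF extremal_second_primitive[OF n c']]
      unfolding Z_def[symmetric] by metis
    have *: "- poisson_mean s (\<lambda>t. - \<nu>\<^sup>2 * (?w t + sgn (cos (real n * t)))) = \<nu>\<^sup>2 * (poisson_norm n s + Z s)"
      if "s > 0" for s
      using poisson_mean_square_wave[OF n c' _ that] \<nu> by (simp add: poisson_mean_def Z_def)
    show thesis
      by (rule that[of D]) (use D in \<open>simp_all only: *\<close>)
  qed

  (* At the start of the iteration Z is known only to satisfy |Z| <= Bw * poisson_norm n s;
     the second summand pays for a negative Z. *)
  define C where "C = 2 * Bf + 2 * M * Bw"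
  define q where "q = (\<nu> / real n)\<^sup>2"
  have iterate: "\<bar>K x s\<bar> \<le> M * (poisson_norm n s + Z s) + C * q ^ m * exp (- real n * s)"
    if "s > 0" for m x s
    using that
  proof (induction m arbitrary: x s)
    case 0
    have w: "\<bar>Z s\<bar> \<le> Bw * poisson_norm n s"
      unfolding Z_def
      by (rule poisson_mean_le_norm[OF 0 extremal_orthogonal_below[OF n c'] extremal_continuous[OF n c'] Bw])
    have "\<bar>K x s\<bar> \<le> Bf * poisson_norm n s"
      unfolding K_def by (rule poisson_mean_le_norm[OF 0 f_orth translates_cont(1) Bf])
    also have "\<dots> \<le> Bf * (2 * exp (- real n * s))"
      by (intro mult_left_mono exp_norm 0 \<open>Bf \<ge> 0\<close>)
    finally have "\<bar>K x s\<bar> \<le> 2 * Bf * exp (- real n * s)" by simp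
    moreover have "M * - Z s \<le> M * (Bw * (2 * exp (- real n * s)))"
      using w mult_left_mono[OF exp_norm[OF 0] \<open>Bw \<ge> 0\<close>] by (intro mult_left_mono \<open>M \<ge> 0\<close>) linarith
    moreover have "M * poisson_norm n s \<ge> 0"
      using poisson_norm_bounds(1)[OF 0] \<open>M \<ge> 0\<close> by simp
    ultimately show ?case by (simp add: C_def algebra_simps)
  next
    case (Suc m)
    define b where "b s = M * Z s / \<nu>\<^sup>2 + C * q ^ m * exp (- real n * s) / (real n)\<^sup>2" for s
    have compare: "b s + \<epsilon> * L x s \<ge> 0" if \<epsilon>: "\<epsilon> = 1 \<or> \<epsilon> = -1" and "s > 0" for \<epsilon> x s
    proof -
      obtain D where D: "\<And>s. s > 0 \<Longrightarrow> (L x has_real_derivative D s) (at s)"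
        "\<And>s. s > 0 \<Longrightarrow> (D has_real_derivative K x s) (at s)"
      proof -
        obtain D where D: "\<And>s. s > 0 \<Longrightarrow> (L x has_real_derivative D s) (at s)"
          "\<And>s. s > 0 \<Longrightarrow> (D has_real_derivative - poisson_mean s (\<lambda>t. - f (x + t))) (at s)"
          using poisson_mean_second_derivative[OF translate_second_primitive[of x]]
          unfolding L_def[symmetric] by metis
        moreover have "- poisson_mean s (\<lambda>t. - f (x + t)) = K x s" for s
          by (simp add: K_def poisson_mean_def)
        ultimately show thesis by (intro that[of D]) simp_all
      qed
      show ?thesis
      proof (rule convex_tendsto_0_nonneg[of "\<lambda>s. b s + \<epsilon> * L x s"])
        fix s :: real assume s: "s > 0"
        show "((\<lambda>s. b s + \<epsilon> * L x s) has_real_derivative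
            M * Z' s / \<nu>\<^sup>2 - C * q ^ m * exp (- real n * s) / real n + \<epsilon> * D s) (at s)"
          unfolding b_def using n \<nu>
          by (auto intro!: derivative_eq_intros Z'[OF s] D[OF s] simp: power2_eq_square mult_ac)
        show "((\<lambda>s. M * Z' s / \<nu>\<^sup>2 - C * q ^ m * exp (- real n * s) / real n + \<epsilon> * D s) has_real_derivative
            M * (poisson_norm n s + Z s) + C * q ^ m * exp (- real n * s) + \<epsilon> * K x s) (at s)"
          using n \<nu> by (auto intro!: derivative_eq_intros Z'[OF s] D[OF s] simp: power2_eq_square)
        show "0 \<le> M * (poisson_norm n s + Z s) + C * q ^ m * exp (- real n * s) + \<epsilon> * K x s"
          using Suc.IH[OF s, of x] \<epsilon> by (auto simp: abs_le_iff)
      next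
        have "filterlim (\<lambda>s. real n * s) at_top at_top"
          using n by (intro filterlim_tendsto_pos_mult_at_top[OF tendsto_const] filterlim_ident) auto
        then have "((\<lambda>s. exp (- real n * s)) \<longlongrightarrow> 0) at_top"
          by (intro filterlim_compose[OF exp_at_bot])
             (simp add: filterlim_uminus_at_bot)
        moreover have "(Z \<longlongrightarrow> 0) at_top"
          unfolding Z_def
          by (rule poisson_mean_tendsto_0[OF n extremal_orthogonal_below[OF n c'] extremal_continuous[OF n c'] Bw])
        moreover have "(L x \<longlongrightarrow> 0) at_top"
          unfolding L_def
          by (rule poisson_mean_tendsto_0[OF n F_orth translates_cont(2) BF])
        ultimately have "((\<lambda>s. b s + \<epsilon> * L x s) \<longlongrightarrow>
            M * 0 / \<nu>\<^sup>2 + C * q ^ m * 0 / (real n)\<^sup>2 + \<epsilon> * 0) at_top"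
          unfolding b_def using n \<nu> by (intro tendsto_intros) auto
        then show "((\<lambda>s. b s + \<epsilon> * L x s) \<longlongrightarrow> 0) at_top" by simp
      qed (rule \<open>s > 0\<close>)
    qed
    have "\<bar>L x s\<bar> \<le> b s" for x
      using compare[of 1 s x] compare[of "-1" s x] Suc.prems by simp
    then have "\<bar>K x s\<bar> \<le> M * poisson_norm n s + \<nu>\<^sup>2 * b s"
      by (rule K_step[OF Suc.prems])
    also have "\<dots> = M * (poisson_norm n s + Z s) + C * q ^ Suc m * exp (- real n * s)"
      using \<nu> by (simp add: b_def q_def power_divide distrib_left mult_ac)
    finally show ?case .
  qed

  have "\<bar>K x s\<bar> \<le> M * (1 + Z s)" if "s > 0" for s
  proof -
    have q: "\<bar>q\<bar> < 1"
      using \<nu> by (simp add: q_def power_less_one_iff abs_if power2_eq_square divide_simps mult_strict_mono)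
    have "(\<lambda>m. M * (poisson_norm n s + Z s) + C * q ^ m * exp (- real n * s))
        \<longlonglongrightarrow> M * (poisson_norm n s + Z s) + C * 0 * exp (- real n * s)"
      using q by (intro tendsto_intros LIMSEQ_abs_realpow_zero2)
    then have "\<bar>K x s\<bar> \<le> M * (poisson_norm n s + Z s) + C * 0 * exp (- real n * s)"
      by (rule LIMSEQ_le_const) (use iterate[OF that] in auto)
    also have "\<dots> \<le> M * (1 + Z s)"
    proof -
      have "1 / cosh (real n * s) \<le> 1" using cosh_real_ge_1 by (simp add: divide_simps)
      then have "poisson_norm n s \<le> 1"
        using poisson_norm_bounds(2)[OF that, of n] by linarith
      then show ?thesis
        using \<open>M \<ge> 0\<close> by (auto intro!: mult_left_mono)
    qed
    finally show ?thesis .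
  qed
  then have "eventually (\<lambda>s. \<bar>K x s\<bar> \<le> M * (1 + Z s)) (at_right 0)"
    by (auto simp: eventually_at_right_less intro: eventually_mono[OF eventually_at_right_less])
  moreover have "((\<lambda>s. \<bar>K x s\<bar>) \<longlongrightarrow> \<bar>f (x + 0)\<bar>) (at_right 0)"
    unfolding K_def
    by (intro tendsto_intros poisson_mean_limit[of "\<lambda>t. f (x + t)" Bf] translates_cont Bf)
  moreover have "((\<lambda>s. M * (1 + Z s)) \<longlongrightarrow> M * (1 + ?w 0)) (at_right 0)"
    unfolding Z_def
    by (intro tendsto_intros poisson_mean_limit[OF _ Bw] extremal_continuous[OF n c'])
  ultimately have "\<bar>f (x + 0)\<bar> \<le> M * (1 + ?w 0)"
    by (intro tendsto_le[of "at_right 0"]) auto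
  then show ?thesis
    using extremal_0[OF n, of \<nu>] by simp
qed

end

text \<open>Integrating twice divides the \<open>j\<close>-th Fourier coefficients by \<open>- j\<^sup>2\<close>, which preserves
  their vanishing for \<open>0 < j < n\<close>; the zeroth one is removed by the constants of
  integration.\<close>

lemma periodic_pair_exists:
  assumes n: "n \<ge> 1" and cont: "continuous_on UNIV f" and per: "\<And>x. f (x + 2 * pi) = f x"
    and orth: "\<And>x. orthogonal_below n (\<lambda>t. f (x + t))"
  obtains F where "periodic_pair n f F"
proof -
  have "mean_zero f"
    using orth[of 0] n unfolding orthogonal_below_def mean_zero_def by (auto dest!: spec[of _ 0])
  then obtain G where G: "\<And>x. (G has_real_derivative f x) (at x)" "\<And>x. G (x + 2 * pi) = G x" "mean_zero G"
    using periodic_mean_zero_primitive[OF cont per] by blast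
  have "continuous_on UNIV G"
    using G by (meson DERIV_isCont continuous_at_imp_continuous_on)
  then obtain E where E: "\<And>x. (E has_real_derivative G x) (at x)" "\<And>x. E (x + 2 * pi) = E x" "mean_zero E"
    using periodic_mean_zero_primitive[OF _ G(2,3)] by blast
  have E_cont: "continuous_on A E" for A
    using E by (meson DERIV_isCont continuous_at_imp_continuous_on)
  have derivs: "((\<lambda>t. E (x + t)) has_real_derivative G (x + t)) (at t)"
      "((\<lambda>t. G (x + t)) has_real_derivative f (x + t)) (at t)" for x t
    by (auto intro!: derivative_eq_intros DERIV_chain2[OF G(1), THEN DERIV_cong]
        DERIV_chain2[OF E(1), THEN DERIV_cong])
  have second: "periodic_second_primitive (\<lambda>t. E (x + t)) (\<lambda>t. f (x + t))" for x
    unfolding periodic_second_primitive_def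
  proof (intro exI conjI ballI)
    show "continuous_on {-pi..pi} (\<lambda>t. G (x + t))" "continuous_on {-pi..pi} (\<lambda>t. E (x + t))"
      using derivs by (meson DERIV_isCont continuous_at_imp_continuous_on)+
    show "E (x + -pi) = E (x + pi)" "G (x + -pi) = G (x + pi)"
      using E(2)[of "x - pi"] G(2)[of "x - pi"] by (simp_all add: algebra_simps)
    show "finite {}" by simp
  qed (use derivs in auto)
  have E_orth: "integral {-pi..pi} (\<lambda>t. cos (real j * t) * E (x + t)) = 0" if "j < n" for j x
  proof (cases "j = 0")
    case True
    then show ?thesis
      using integral_period_shift[OF E_cont E(2), of x] E(3) by (simp add: mean_zero_def)
  next
    case False
    have "((\<lambda>t. cos (real j * t) * f (x + t)) has_integral
        integral {-pi..pi} (\<lambda>t. - (real j)\<^sup>2 * cos (real j * t) * E (x + t))) {-pi..pi}"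
      by (rule periodic_green[OF second, where \<phi>' = "\<lambda>t. - real j * sin (real j * t)"])
         (auto intro!: derivative_eq_intros continuous_intros simp: power2_eq_square)
    then have "integral {-pi..pi} (\<lambda>t. - (real j)\<^sup>2 * cos (real j * t) * E (x + t)) = 0"
      using orth[of x] \<open>j < n\<close> by (auto simp: orthogonal_below_def dest: integral_unique)
    then show ?thesis using False by (simp add: mult.assoc)
  qed
  have "periodic_pair n f (\<lambda>x. - E x)"
  proof
    show "\<exists>V. (\<forall>x. ((\<lambda>x. - E x) has_real_derivative V x) (at x)) \<and>
        (\<forall>x. (V has_real_derivative - f x) (at x)) \<and> (\<forall>x. V (x + 2 * pi) = V x)"
      by (rule exI[of _ "\<lambda>x. - G x"]) (auto intro!: derivative_eq_intros E G simp: G(2))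
    show "orthogonal_below n (\<lambda>t. - E (x + t))" for x
      using E_orth by (simp add: orthogonal_below_def)
  qed (use assms E(2) in auto)
  then show thesis by (rule that)
qed

section \<open>Averaging the difference\<close>

lemma sum_centred:
  fixes \<phi> :: "nat \<Rightarrow> real"
  shows "(\<Sum>j=0..2 * k. \<phi> j) = \<phi> k + (\<Sum>i=1..k. \<phi> (k + i) + \<phi> (k - i))"
proof (induction k arbitrary: \<phi>)
  case (Suc k)
  have "(\<Sum>j=0..2 * Suc k. \<phi> j) = \<phi> 0 + (\<Sum>j=0..2 * k. \<phi> (Suc j)) + \<phi> (2 * k + 2)"
  proof -
    have "(\<Sum>j=0..2 * Suc k. \<phi> j) = (\<Sum>j=0..Suc (2 * k). \<phi> j) + \<phi> (2 * k + 2)"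
      by simp
    also have "(\<Sum>j=0..Suc (2 * k). \<phi> j) = \<phi> 0 + (\<Sum>j=0..2 * k. \<phi> (Suc j))"
      by (rule sum.atLeast0_atMost_Suc_shift[unfolded o_def])
    finally show ?thesis .
  qed
  also have "(\<Sum>j=0..2 * k. \<phi> (Suc j)) = \<phi> (Suc k) + (\<Sum>i=1..k. \<phi> (Suc (k + i)) + \<phi> (Suc (k - i)))"
    by (rule Suc.IH)
  also have "(\<Sum>i=1..k. \<phi> (Suc (k + i)) + \<phi> (Suc (k - i))) = (\<Sum>i=1..k. \<phi> (Suc k + i) + \<phi> (Suc k - i))"
    by (intro sum.cong) (auto simp: Suc_diff_le)
  finally show ?case by (simp add: numeral_2_eq_2)
qed simp

lemma fdiff_centred:
  "(-1) ^ k * gamma_star k * fdiff (2 * k) t f (x - real k * t)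
    = f x + (\<Sum>i=1..k. (-1) ^ i * a_coeff k i * (f (x + real i * t) + f (x - real i * t)))"
proof -
  have g: "gamma_star k * real (2 * k choose k) = 1"
    by (simp add: gamma_star_def)
  have a: "gamma_star k * real (2 * k choose (k + i)) = a_coeff k i" for i
    by (simp add: gamma_star_def a_coeff_def field_simps)
  have a': "gamma_star k * real (2 * k choose (k - i)) = a_coeff k i" if "i \<le> k" for i
  proof -
    have "2 * k choose (k - i) = 2 * k choose (2 * k - (k - i))"
      using that by (intro binomial_symmetric) simp
    also have "2 * k - (k - i) = k + i" using that by simp
    finally show ?thesis by (simp add: a)
  qed
  have sq: "(-1) ^ k * (-1) ^ k = (1::real)" by (simp add: power_add[symmetric])
  have sign: "(-1) ^ k * (-1) ^ (k - i) = (-1::real) ^ i" if "i \<le> k" for i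
  proof -
    have "(-1::real) ^ k = (-1) ^ (k - i) * (-1) ^ i" using that by (simp add: power_add[symmetric])
    moreover have "(-1) ^ (k - i) * (-1) ^ (k - i) = (1::real)" by (simp add: power_add[symmetric])
    ultimately show ?thesis by simp
  qed
  define \<phi> where "\<phi> j = (-1) ^ k * gamma_star k *
      ((-1) ^ j * real (2 * k choose j) * f (x - real k * t + real j * t))" for j
  have mid: "\<phi> k = f x"
  proof -
    have "\<phi> k = ((-1) ^ k * (-1) ^ k) * (gamma_star k * real (2 * k choose k)) * f x"
      by (simp add: \<phi>_def)
    then show ?thesis unfolding sq g by simp
  qed
  have up: "\<phi> (k + i) = (-1) ^ i * a_coeff k i * f (x + real i * t)" for i
  proof -
    have "\<phi> (k + i) = ((-1) ^ k * (-1) ^ k) * (-1) ^ i * (gamma_star k * real (2 * k choose (k + i))) * f (x + real i * t)"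
      by (simp add: \<phi>_def power_add algebra_simps)
    then show ?thesis unfolding sq a by simp
  qed
  have down: "\<phi> (k - i) = (-1) ^ i * a_coeff k i * f (x - real i * t)" if "i \<le> k" for i
  proof -
    have "x - real k * t + real (k - i) * t = x - real i * t"
      using that by (simp add: of_nat_diff algebra_simps)
    then have "\<phi> (k - i) = ((-1) ^ k * (-1) ^ (k - i)) * (gamma_star k * real (2 * k choose (k - i))) * f (x - real i * t)"
      unfolding \<phi>_def by (simp only: mult_ac)
    then show ?thesis unfolding sign[OF that] a'[OF that] .
  qed
  have "(-1) ^ k * gamma_star k * fdiff (2 * k) t f (x - real k * t) = (\<Sum>j=0..2 * k. \<phi> j)"
    by (simp add: fdiff_def \<phi>_def sum_distrib_left)
  also have "\<dots> = f x + (\<Sum>i=1..k. (-1) ^ i * a_coeff k i * (f (x + real i * t) + f (x - real i * t)))"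
    unfolding sum_centred mid
    by (intro arg_cong2[of _ _ _ _ "(+)"] sum.cong) (auto simp: up down distrib_left)
  finally show ?thesis .
qed

lemma fdiff_0: "r > 0 \<Longrightarrow> fdiff r 0 f x = 0"
  using choose_alternating_sum[of r, where 'a = real]
  by (simp add: fdiff_def atLeast0AtMost sum_distrib_right[symmetric])

lemma abs_fdiff_le_modulus:
  assumes bound: "\<And>x. \<bar>f x\<bar> \<le> B" and "0 < t" "t \<le> h"
  shows "\<bar>fdiff r t f x\<bar> \<le> modulus r f h"
proof -
  define C where "C = (\<Sum>i=0..r. real (r choose i) * B)"
  have C: "\<bar>fdiff r t f x\<bar> \<le> C" for t x
    unfolding fdiff_def C_def
    by (rule order_trans[OF sum_abs]) (auto intro!: sum_mono mult_left_mono bound simp: abs_mult power_abs)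
  have "\<bar>fdiff r t f x\<bar> \<le> unorm (fdiff r t f)"
    unfolding unorm_def by (rule cSUP_upper) (use C in \<open>auto intro!: bdd_aboveI2\<close>)
  also have "\<dots> \<le> modulus r f h"
    unfolding modulus_def
  proof (rule cSUP_upper)
    show "bdd_above ((\<lambda>t. unorm (fdiff r t f)) ` {0<..h})"
      unfolding unorm_def by (intro bdd_aboveI2[of _ _ C] cSUP_least) (auto simp: C)
  qed (use assms in auto)
  finally show ?thesis .
qed

lemma alternating_sum_nonneg:
  fixes b :: "nat \<Rightarrow> real"
  assumes decr: "\<And>i. b (Suc i) \<le> b i" and nonneg: "\<And>i. b i \<ge> 0"
  shows "(\<Sum>i<m. (-1) ^ i * b i) \<ge> 0"
proof -
  have "(even m \<longrightarrow> (\<Sum>i<m. (-1) ^ i * b i) \<ge> 0) \<and> (odd m \<longrightarrow> (\<Sum>i<m. (-1) ^ i * b i) \<ge> b m)"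
  proof (induction m)
    case (Suc m)
    show ?case
    proof (cases "even m")
      case True
      then show ?thesis using Suc decr[of m] by simp
    next
      case False
      then show ?thesis using Suc by simp
    qed
  qed simp
  then show ?thesis using nonneg[of m] by (cases "even m") auto
qed

lemma a_coeff_decreasing: "a_coeff k (Suc i) \<le> a_coeff k i"
proof (cases "Suc i \<le> k")
  case True
  have "2 * k choose (k + Suc i) \<le> 2 * k choose (k + i)"
    using True by (intro binomial_antimono) auto
  then show ?thesis by (simp add: a_coeff_def divide_right_mono)
qed (simp add: a_coeff_def binomial_eq_0)

text \<open>The averages of \<open>f (x + i \<tau> h) + f (x - i \<tau> h)\<close> taken below are second differences of
  the second primitive divided by \<open>- (i h)\<^sup>2\<close>; with this coefficient the second difference
  of step \<open>i h\<close> is subtracted from \<open>f x\<close>.\<close>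

definition averaged_coeff :: "nat \<Rightarrow> real \<Rightarrow> nat \<Rightarrow> real" where
  "averaged_coeff k h i = 2 * (-1) ^ i * a_coeff k i / (real i * h)\<^sup>2"

text \<open>The same expression as a combination of the translates by \<open>(j - k) h\<close>,
  \<open>j = 0, \<dots>, 2 k\<close>.\<close>

definition centred_coeff :: "nat \<Rightarrow> real \<Rightarrow> nat \<Rightarrow> real" where
  "centred_coeff k h j =
    (if j = k then - 2 * (\<Sum>i=1..k. averaged_coeff k h i)
     else averaged_coeff k h (if j < k then k - j else j - k))"

lemma sum_centred_coeff:
  "(\<Sum>j=0..2 * k. centred_coeff k h j * \<phi> (real j - real k))
    = (\<Sum>i=1..k. averaged_coeff k h i * (\<phi> (real i) + \<phi> (- real i) - 2 * \<phi> 0))"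
proof -
  have "(\<Sum>j=0..2 * k. centred_coeff k h j * \<phi> (real j - real k))
    = centred_coeff k h k * \<phi> 0 + (\<Sum>i=1..k. averaged_coeff k h i * (\<phi> (real i) + \<phi> (- real i)))"
    unfolding sum_centred
    by (intro arg_cong2[of _ _ _ _ "(+)"] sum.cong)
       (auto simp: centred_coeff_def of_nat_diff algebra_simps)
  also have "\<dots> = (\<Sum>i=1..k. averaged_coeff k h i * (\<phi> (real i) + \<phi> (- real i)))
      - (\<Sum>i=1..k. averaged_coeff k h i * (2 * \<phi> 0))"
    by (simp add: centred_coeff_def sum_distrib_right[symmetric])
  also have "\<dots> = (\<Sum>i=1..k. averaged_coeff k h i * (\<phi> (real i) + \<phi> (- real i) - 2 * \<phi> 0))"
    unfolding sum_subtractf[symmetric] by (simp add: right_diff_distrib)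
  finally show ?thesis .
qed

text \<open>The central coefficient is nonnegative, because the \<open>a_coeff k i / i\<^sup>2\<close> decrease and their
  alternating sum begins with a positive term. Hence it cancels the even coefficients and doubles
  the odd ones in the sum of the absolute values: this is where the sum over odd \<open>i\<close> in
  the definition of \<open>mu\<close> comes from.\<close>

lemma sum_abs_centred_coeff:
  assumes "k \<ge> 1" "h > 0"
  shows "(\<Sum>j=0..2 * k. \<bar>centred_coeff k h j\<bar>) = (pi * mu k / h)\<^sup>2"
proof -
  define b where "b i = a_coeff k i / (real i)\<^sup>2" for i
  have b: "b i \<ge> 0" for i by (simp add: b_def a_coeff_def)
  have e: "averaged_coeff k h i = 2 / h\<^sup>2 * ((-1) ^ i * b i)" for i
    by (simp add: averaged_coeff_def b_def power_mult_distrib mult_ac)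
  have abs_e: "\<bar>averaged_coeff k h i\<bar> = 2 / h\<^sup>2 * b i" for i
    using b[of i] by (simp add: e abs_mult power_abs)
  have central: "(\<Sum>i=1..k. (-1) ^ i * b i) \<le> 0"
  proof -
    have "(\<Sum>i<k. (-1) ^ i * b (Suc i)) \<ge> 0"
    proof (rule alternating_sum_nonneg)
      show "b (Suc (Suc i)) \<le> b (Suc i)" for i
        unfolding b_def using a_coeff_decreasing[of k "Suc i"]
        by (intro frac_le) (auto simp: a_coeff_def)
    qed (rule b)
    also have "(\<Sum>i<k. (-1) ^ i * b (Suc i)) = - (\<Sum>i=1..k. (-1) ^ i * b i)"
      by (simp add: sum.atLeast1_atMost_eq sum_negf)
    finally show ?thesis by simp
  qed
  have "(\<Sum>j=0..2 * k. \<bar>centred_coeff k h j\<bar>)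
      = \<bar>2 * (\<Sum>i=1..k. averaged_coeff k h i)\<bar> + 2 * (\<Sum>i=1..k. \<bar>averaged_coeff k h i\<bar>)"
    unfolding sum_centred sum_distrib_left[of 2 "\<lambda>i. \<bar>averaged_coeff k h i\<bar>"]
    by (intro arg_cong2[of _ _ _ _ "(+)"] sum.cong) (auto simp: centred_coeff_def abs_mult)
  also have "(\<Sum>i=1..k. averaged_coeff k h i) = 2 / h\<^sup>2 * (\<Sum>i=1..k. (-1) ^ i * b i)"
    unfolding e by (simp add: sum_distrib_left)
  also have "\<bar>2 * \<dots>\<bar> = - (4 / h\<^sup>2 * (\<Sum>i=1..k. (-1) ^ i * b i))"
    using central assms(2) by (simp add: abs_mult)
  also have "(\<Sum>i=1..k. \<bar>averaged_coeff k h i\<bar>) = 2 / h\<^sup>2 * (\<Sum>i=1..k. b i)"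
    unfolding abs_e by (simp add: sum_distrib_left)
  also have "- (4 / h\<^sup>2 * (\<Sum>i=1..k. (-1) ^ i * b i)) + 2 * (2 / h\<^sup>2 * (\<Sum>i=1..k. b i))
      = 4 / h\<^sup>2 * (\<Sum>i=1..k. b i - (-1) ^ i * b i)"
    by (simp add: sum_subtractf algebra_simps)
  also have "(\<Sum>i=1..k. b i - (-1) ^ i * b i) = (\<Sum>i=1..k. if odd i then 2 * b i else 0)"
    by (intro sum.cong) auto
  also have "\<dots> = (\<Sum>i | 1 \<le> i \<and> i \<le> k \<and> odd i. 2 * b i)"
    by (subst sum.If_cases) (auto intro!: sum.cong)
  also have "\<dots> = 2 * (\<Sum>i | 1 \<le> i \<and> i \<le> k \<and> odd i. b i)"
    by (rule sum_distrib_left[symmetric])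
  also have "4 / h\<^sup>2 * \<dots> = (pi * mu k / h)\<^sup>2"
    using mu_pos_square(2)[OF assms(1)] assms(2)
    by (simp add: power_mult_distrib power_divide b_def)
  finally show ?thesis .
qed

context periodic_pair begin

text \<open>Two integrations by parts with the weight \<open>1 - \<tau>\<close>; the boundary terms with \<open>F'\<close> cancel
  between \<open>H\<close> and \<open>- H\<close>.\<close>

lemma hat_average:
  assumes "H \<noteq> 0"
  shows "((\<lambda>\<tau>. (1 - \<tau>) * (f (x + \<tau> * H) + f (x - \<tau> * H))) has_integral
      (2 * F x - F (x + H) - F (x - H)) / H\<^sup>2) {0..1}"
proof -
  obtain V where V: "\<And>x. (F has_real_derivative V x) (at x)" "\<And>x. (V has_real_derivative - f x) (at x)"
    using primitive by blast
  have one_sided: "((\<lambda>\<tau>. (1 - \<tau>) * f (x + \<tau> * H)) has_integral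
      V x / H + (F x - F (x + H)) / H\<^sup>2) {0..1}" if "H \<noteq> 0" for H
  proof -
    define \<Psi> where "\<Psi> \<tau> = - (1 - \<tau>) * V (x + \<tau> * H) / H - F (x + \<tau> * H) / H\<^sup>2" for \<tau>
    have "((\<lambda>\<tau>. F (x + \<tau> * H)) has_real_derivative V (x + \<tau> * H) * H) (at \<tau>)"
      "((\<lambda>\<tau>. V (x + \<tau> * H)) has_real_derivative - f (x + \<tau> * H) * H) (at \<tau>)" for \<tau>
      by (auto intro!: derivative_eq_intros DERIV_chain2[OF V(1), THEN DERIV_cong]
          DERIV_chain2[OF V(2), THEN DERIV_cong])
    then have "(\<Psi> has_real_derivative (1 - \<tau>) * f (x + \<tau> * H)) (at \<tau>)" for \<tau>
      unfolding \<Psi>_def using that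
      by (auto intro!: derivative_eq_intros simp: power2_eq_square field_simps)
    then have "((\<lambda>\<tau>. (1 - \<tau>) * f (x + \<tau> * H)) has_integral \<Psi> 1 - \<Psi> 0) {0..1}"
      by (intro fundamental_theorem_of_calculus)
         (auto simp: has_real_derivative_iff_has_vector_derivative[symmetric] intro: has_field_derivative_at_within)
    moreover have "\<Psi> 1 - \<Psi> 0 = V x / H + (F x - F (x + H)) / H\<^sup>2"
      by (simp add: \<Psi>_def diff_divide_distrib)
    ultimately show ?thesis by simp
  qed
  have "((\<lambda>\<tau>. (1 - \<tau>) * f (x + \<tau> * H) + (1 - \<tau>) * f (x + \<tau> * (- H))) has_integral
      (V x / H + (F x - F (x + H)) / H\<^sup>2) + (V x / (- H) + (F x - F (x + (- H))) / (- H)\<^sup>2)) {0..1}"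
    using assms by (intro has_integral_add one_sided) auto
  then show ?thesis
    by (simp add: distrib_left add_divide_distrib[symmetric] algebra_simps)
qed

text \<open>The weight \<open>2 (1 - \<tau>)\<close> has integral 1. Averaging the normalised centred difference of
  step \<open>\<tau> h\<close> with it leaves \<open>f x\<close> alone and turns each pair of translates of \<open>f\<close> into a
  second difference of \<open>F\<close>.\<close>

lemma averaged_difference_bound:
  assumes "k \<ge> 1" "h > 0"
  shows "\<bar>f x - (\<Sum>j\<in>{0..2 * k}. centred_coeff k h j * F (x + (real j - real k) * h))\<bar>
    \<le> gamma_star k * modulus (2 * k) f h"
proof -
  obtain Bf where Bf: "\<And>x. \<bar>f x\<bar> \<le> Bf"
    using continuous_periodic_bounded[OF f_cont f_per] by blast
  define R where "R t = (-1) ^ k * gamma_star k * fdiff (2 * k) t f (x - real k * t)" for t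
  define M where "M = gamma_star k * modulus (2 * k) f h"
  have \<gamma>: "gamma_star k \<ge> 0" by (simp add: gamma_star_def)
  have "0 \<le> \<bar>fdiff (2 * k) h f 0\<bar>" by simp
  also have "\<dots> \<le> modulus (2 * k) f h" using assms by (intro abs_fdiff_le_modulus[OF Bf]) auto
  finally have M: "M \<ge> 0" using \<gamma> by (simp add: M_def)
  have R: "\<bar>R (\<tau> * h)\<bar> \<le> M" if "\<tau> \<in> {0..1}" for \<tau>
  proof (cases "\<tau> = 0")
    case True
    then show ?thesis using M assms(1) by (simp add: R_def fdiff_0)
  next
    case False
    then have "0 < \<tau> * h" "\<tau> * h \<le> h" using that assms by auto
    from abs_fdiff_le_modulus[OF Bf this] show ?thesis
      using \<gamma> by (auto simp: R_def M_def abs_mult power_abs intro!: mult_left_mono)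
  qed
  have weight: "((\<lambda>\<tau>. 2 * (1 - \<tau>)) has_integral (1::real)) {0..1}"
  proof -
    have "((\<lambda>\<tau>. 2 * \<tau> - \<tau>\<^sup>2) has_real_derivative 2 * (1 - \<tau>)) (at \<tau>)" for \<tau> :: real
      by (auto intro!: derivative_eq_intros)
    then have "((\<lambda>\<tau>. 2 * (1 - \<tau>)) has_integral (2 * 1 - 1\<^sup>2) - (2 * 0 - 0\<^sup>2)) {0..1::real}"
      by (intro fundamental_theorem_of_calculus)
         (auto simp: has_real_derivative_iff_has_vector_derivative[symmetric] intro: has_field_derivative_at_within)
    then show ?thesis by simp
  qed
  define J where "J = f x + (\<Sum>i=1..k. 2 * (-1) ^ i * a_coeff k i *
      ((2 * F x - F (x + real i * h) - F (x - real i * h)) / (real i * h)\<^sup>2))"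
  have "((\<lambda>\<tau>. 2 * (1 - \<tau>) * f x + (\<Sum>i=1..k. 2 * (-1) ^ i * a_coeff k i *
      ((1 - \<tau>) * (f (x + \<tau> * (real i * h)) + f (x - \<tau> * (real i * h)))))) has_integral
      1 * f x + (\<Sum>i=1..k. 2 * (-1) ^ i * a_coeff k i *
      ((2 * F x - F (x + real i * h) - F (x - real i * h)) / (real i * h)\<^sup>2))) {0..1}"
    using assms
    by (intro has_integral_add has_integral_mult_left weight has_integral_sum has_integral_mult_right hat_average) auto
  moreover have "2 * (1 - \<tau>) * f x + (\<Sum>i=1..k. 2 * (-1) ^ i * a_coeff k i *
      ((1 - \<tau>) * (f (x + \<tau> * (real i * h)) + f (x - \<tau> * (real i * h))))) = 2 * (1 - \<tau>) * R (\<tau> * h)" for \<tau>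
    unfolding R_def fdiff_centred distrib_left[of "2 * (1 - \<tau>)"] sum_distrib_left
    by (intro arg_cong2[of _ _ _ _ "(+)"] sum.cong) (simp_all only: mult_ac)
  ultimately have J: "((\<lambda>\<tau>. 2 * (1 - \<tau>) * R (\<tau> * h)) has_integral J) {0..1}"
    by (simp add: J_def)
  have pointwise: "- M \<le> R (\<tau> * h)" "R (\<tau> * h) \<le> M" if "\<tau> \<in> {0..1}" for \<tau>
    using R[OF that] by linarith+
  have "J \<le> 1 * M"
    by (rule has_integral_le[OF J has_integral_mult_left[OF weight]])
       (intro mult_left_mono pointwise, auto)
  moreover have "1 * (- M) \<le> J"
    by (rule has_integral_le[OF has_integral_mult_left[OF weight] J])
       (intro mult_left_mono pointwise, auto)
  ultimately have "\<bar>J\<bar> \<le> M" by simp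
  have "(\<Sum>j\<in>{0..2 * k}. centred_coeff k h j * F (x + (real j - real k) * h))
      = (\<Sum>i=1..k. averaged_coeff k h i * (F (x + real i * h) + F (x - real i * h) - 2 * F x))"
    using sum_centred_coeff[of k h "\<lambda>r. F (x + r * h)"] by simp
  then have "f x - (\<Sum>j\<in>{0..2 * k}. centred_coeff k h j * F (x + (real j - real k) * h))
      = f x + (\<Sum>i=1..k. - (averaged_coeff k h i * (F (x + real i * h) + F (x - real i * h) - 2 * F x)))"
    by (simp add: sum_negf)
  also have "\<dots> = J"
  proof -
    have neg: "- (a / b * c) = a * (e / b)" if "e = - c" for a b c e :: real
      using that by simp
    show ?thesis
      unfolding J_def averaged_coeff_def
      by (intro arg_cong2[of _ _ _ _ "(+)"] sum.cong refl neg) simp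
  qed
  finally show ?thesis using \<open>\<bar>J\<bar> \<le> M\<close> by (simp add: M_def)
qed

end

section \<open>The Jackson-Stechkin inequality\<close>

text \<open>The trigonometric polynomials of degree below \<open>n\<close> are invariant under translation.\<close>

lemma trig_perp_orthogonal_translates:
  assumes "n \<ge> 1" "f \<in> trig_perp (n - 1)"
  shows "orthogonal_below n (\<lambda>t. f (x + t))"
  unfolding orthogonal_below_def
proof (intro allI impI)
  fix j assume "j < n"
  have cont: "continuous_on UNIV f" and per: "\<And>x. f (x + 2 * pi) = f x"
    and orth: "\<And>\<tau>. \<tau> \<in> trig_poly (n - 1) \<Longrightarrow> integral {-pi..pi} (\<lambda>x. f x * \<tau> x) = 0"
    using assms(2) by (auto simp: trig_perp_def periodic_cont_def)
  define \<tau> where "\<tau> t = cos (real j * (t - x))" for t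
  have "\<tau> \<in> trig_poly (n - 1)"
  proof -
    define a where "a i = (if i = j then cos (real j * x) else 0)" for i
    define b where "b i = (if i = j then sin (real j * x) else 0)" for i
    have "\<tau> t = a 0 + (\<Sum>i=1..n - 1. a i * cos (real i * t) + b i * sin (real i * t))" for t
    proof (cases "j = 0")
      case True
      then show ?thesis by (simp add: \<tau>_def a_def b_def)
    next
      case False
      have "(\<Sum>i=1..n - 1. a i * cos (real i * t) + b i * sin (real i * t))
          = (\<Sum>i=1..n - 1. if i = j then a j * cos (real j * t) + b j * sin (real j * t) else 0)"
        by (intro sum.cong) (auto simp: a_def b_def)
      also have "\<dots> = a j * cos (real j * t) + b j * sin (real j * t)"
        using False \<open>j < n\<close> by (subst sum.delta) auto
      also have "\<dots> = \<tau> t"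
        unfolding \<tau>_def right_diff_distrib cos_diff by (simp add: a_def b_def)
      finally show ?thesis using False by (simp add: a_def)
    qed
    then have "\<tau> = (\<lambda>t. a 0 + (\<Sum>i=1..n - 1. a i * cos (real i * t) + b i * sin (real i * t)))"
      by blast
    then show ?thesis unfolding trig_poly_def by blast
  qed
  then have "integral {-pi..pi} (\<lambda>t. f t * \<tau> t) = 0" by (rule orth)
  moreover have "integral {-pi..pi} (\<lambda>t. f (x + t) * \<tau> (x + t)) = integral {-pi..pi} (\<lambda>t. f t * \<tau> t)"
  proof (rule integral_period_shift)
    show "continuous_on UNIV (\<lambda>t. f t * \<tau> t)"
      unfolding \<tau>_def by (intro continuous_intros cont)
    have "real j * (t + 2 * pi - x) = real j * (t - x) + 2 * real j * pi" for t
      by (simp add: algebra_simps)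
    then show "f (t + 2 * pi) * \<tau> (t + 2 * pi) = f t * \<tau> t" for t
      by (simp add: \<tau>_def per cos_add sin_2npi cos_2npi)
  qed
  ultimately show "integral {-pi..pi} (\<lambda>t. cos (real j * t) * f (x + t)) = 0"
    by (simp add: \<tau>_def mult.commute)
qed

theorem proposition4p4:
  fixes k n :: nat and f :: "real \<Rightarrow> real" and h :: real
  assumes "k \<ge> 1" and "n \<ge> 1"
    and "f \<in> trig_perp (n - 1)"
    and "h > pi / real n * mu k"
  shows "rho n k h < 1 \<and>
    unorm f \<le> c_const n k h * gamma_star k * modulus (2 * k) f h"
proof -
  have \<mu>: "mu k > 0" by (rule mu_pos_square(1)[OF assms(1)])
  then have "0 < pi / real n * mu k" using assms(2) by simp
  then have h: "h > 0" using assms(4) by linarith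
  (* The square of this is the sum of the absolute values of the centred coefficients, and its
     ratio to n is rho n k h. *)
  define \<nu> where "\<nu> = pi * mu k / h"
  have \<nu>: "0 < \<nu>" "\<nu> < real n"
    using \<mu> h assms(2,4) by (auto simp: \<nu>_def field_simps)
  have \<rho>: "rho n k h = \<nu> / real n" by (simp add: rho_def \<nu>_def)
  have "continuous_on UNIV f" "\<And>x. f (x + 2 * pi) = f x"
    using assms(3) by (auto simp: trig_perp_def periodic_cont_def)
  from periodic_pair_exists[OF assms(2) this trig_perp_orthogonal_translates[OF assms(2,3)]]
  obtain F where "periodic_pair n f F" .
  then interpret periodic_pair n f F .
  have "(\<Sum>j=0..2 * k. \<bar>centred_coeff k h j\<bar>) \<le> \<nu>\<^sup>2"
    unfolding sum_abs_centred_coeff[OF assms(1) h] \<nu>_def by (rule order_refl)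
  then have "\<bar>f x\<bar> \<le> gamma_star k * modulus (2 * k) f h / cos (\<nu> * pi / (2 * real n))" for x
    by (rule perturbed_bohr_favard[OF \<nu> finite_atLeastAtMost _ averaged_difference_bound[OF assms(1) h]])
  then have "unorm f \<le> gamma_star k * modulus (2 * k) f h / cos (\<nu> * pi / (2 * real n))"
    unfolding unorm_def by (intro cSUP_least) auto
  also have "\<nu> * pi / (2 * real n) = pi / 2 * rho n k h"
    by (simp add: \<rho>)
  also have "gamma_star k * modulus (2 * k) f h / cos (pi / 2 * rho n k h)
      = c_const n k h * gamma_star k * modulus (2 * k) f h"
    unfolding c_const_def divide_inverse by (simp only: mult_ac)
  finally show ?thesis
    using \<nu> assms(2) by (simp add: \<rho>)
qed

end
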